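(* Let $H$ be a graded connected Hopf algebra over $\Bbbk$, not one-dimensional, with finite-dimensional homogeneous components $H_m$ and antipode $S$. Put $h_m=\dim H_m$ and $a_m=\operatorname{trace}(S|_{H_m})$. Assume there is a meromorphic function $h(z)$ of a complex variable $z$, holomorphic on a neighborhood of $0$, whose Taylor expansion at $0$ is $\sum_{m\ge0}h_m z^m$. Let $R$ be the positive real number at which a dominant singularity of $h(z)$ (a singularity of smallest modulus) occurs; one has $0<R\le1$. Suppose that $R$ is the unique singularity of $h(z)$ in the disk $|z|\le R^{1/4}$, and let $\gamma$ be the order of this singularity. Suppose further that $h(z)$ is nonzero in the disk $|z|\le R^{1/2}$, and that $h(-R^{1/2})\ne\pm h(R^{1/2})$. Then, as $m\to\infty$, $$\frac{a_m}{h_m}\sim\frac{R^{m/2}}{2^{\gamma}}\Bigl(\frac{1}{h(R^{1/2})}+(-1)^m\frac{1}{h(-R^{1/2})}\Bigr).$$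
   Context: $\Bbbk$ is a field of characteristic zero. A graded connected Hopf algebra is a bialgebra $H$ with product $\mu$, coproduct $\Delta$, unit $1$, counit $\varepsilon$ and a decomposition $H=\bigoplus_{m\ge 0}H_m$ such that $\mu(H_p\otimes H_q)\subseteq H_{p+q}$, $\Delta(H_m)\subseteq\bigoplus_{p+q=m}H_p\otimes H_q$, $1\in H_0$, $\varepsilon(H_m)=0$ for $m>0$, and $\dim H_0=1$. It automatically has an antipode $S$, and $S(H_m)\subseteq H_m$ for all $m$. The traces $a_m$ are integers, regarded as complex numbers. The one-dimensional Hopf algebra $H=\Bbbk$ is excluded. That the positive real radius of convergence $R$ is itself a singularity follows from Pringsheim's theorem (the $h_m$ being nonnegative), and $R\le1$ since infinitely many $h_m$ are nonzero. "Order" of the singularity means the order of the pole. If $R=1$, then $h(R^{1/2})$ is the value at a pole, and it is read as $\infty$, with $1/h(R^{1/2})=0$. The notation $u_m\sim v_m$ means $u_m/v_m\to1$. *)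

theory Defs
  imports "HOL-Complex_Analysis.Complex_Analysis" "HOL-Library.Poly_Mapping"
begin

text \<open>The free vector space on a type \<open>'i\<close> is \<open>'i \<Rightarrow>\<^sub>0 'k\<close>; it carries the following scalar
  multiplication, basis, and linear extension of a map defined on the basis.\<close>

definition free_scale :: "'k::field \<Rightarrow> ('i \<Rightarrow>\<^sub>0 'k) \<Rightarrow> ('i \<Rightarrow>\<^sub>0 'k)" where
  "free_scale c t = Poly_Mapping.map ((*) c) t"

definition gen :: "'i \<Rightarrow> ('i \<Rightarrow>\<^sub>0 'k::field)" where
  "gen i = Poly_Mapping.single i 1"

definition lin_ext :: "('k::field \<Rightarrow> 'v::ab_group_add \<Rightarrow> 'v) \<Rightarrow> ('i \<Rightarrow> 'v) \<Rightarrow> ('i \<Rightarrow>\<^sub>0 'k) \<Rightarrow> 'v" where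
  "lin_ext smul g t = (\<Sum>i\<in>Poly_Mapping.keys t. smul (Poly_Mapping.lookup t i) (g i))"

lemma lookup_free_scale [simp]:
  "Poly_Mapping.lookup (free_scale c t) i = c * Poly_Mapping.lookup t i"
  by (auto simp: free_scale_def Poly_Mapping.map.rep_eq when_def)

lemma vector_space_free_scale: "vector_space (free_scale :: 'k::field \<Rightarrow> ('i \<Rightarrow>\<^sub>0 'k) \<Rightarrow> _)"
  by unfold_locales (auto intro!: poly_mapping_eqI simp: lookup_add algebra_simps)

text \<open>Tensor powers as quotients of free vector spaces. A type cannot depend on the term
  \<open>smul\<close>, so elements of \<open>H \<otimes> H\<close> and \<open>H \<otimes> H \<otimes> H\<close> are handled through representatives in the
  free vector spaces on \<open>H \<times> H\<close> and \<open>H \<times> H \<times> H\<close>, and equality in the tensor power is congruence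
  modulo the subspace spanned by the relations that make \<open>gen (x, y)\<close> bilinear, respectively
  \<open>gen (x, y, z)\<close> trilinear. The set \<open>slots\<close> contains, for each tensor factor, the maps that
  insert a vector there while the other entries stay fixed.\<close>

definition multilinear_relations ::
    "('k::field \<Rightarrow> 'a::ab_group_add \<Rightarrow> 'a) \<Rightarrow> ('a \<Rightarrow> 'i) set \<Rightarrow> ('i \<Rightarrow>\<^sub>0 'k) set" where
  "multilinear_relations smul slots = module.span free_scale
     ({gen (f (x + y)) - (gen (f x) + gen (f y)) | f x y. f \<in> slots} \<union>
      {gen (f (smul c x)) - free_scale c (gen (f x)) | f c x. f \<in> slots})"

definition tensor2_eq ::
    "('k::field \<Rightarrow> 'a::ab_group_add \<Rightarrow> 'a) \<Rightarrow> ('a \<times> 'a \<Rightarrow>\<^sub>0 'k) \<Rightarrow> ('a \<times> 'a \<Rightarrow>\<^sub>0 'k) \<Rightarrow> bool" where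
  "tensor2_eq smul t u \<longleftrightarrow>
     t - u \<in> multilinear_relations smul (range (\<lambda>y x. (x, y)) \<union> range (\<lambda>x y. (x, y)))"

definition tensor3_eq ::
    "('k::field \<Rightarrow> 'a::ab_group_add \<Rightarrow> 'a) \<Rightarrow>
      ('a \<times> 'a \<times> 'a \<Rightarrow>\<^sub>0 'k) \<Rightarrow> ('a \<times> 'a \<times> 'a \<Rightarrow>\<^sub>0 'k) \<Rightarrow> bool" where
  "tensor3_eq smul t u \<longleftrightarrow>
     t - u \<in> multilinear_relations smul
       (range (\<lambda>(y, z) x. (x, y, z)) \<union> range (\<lambda>(x, z) y. (x, y, z)) \<union> range (\<lambda>(x, y) z. (x, y, z)))"

definition tensor2_mult ::
    "('a::ring_1 \<times> 'a \<Rightarrow>\<^sub>0 'k::field) \<Rightarrow> ('a \<times> 'a \<Rightarrow>\<^sub>0 'k) \<Rightarrow> ('a \<times> 'a \<Rightarrow>\<^sub>0 'k)" where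
  "tensor2_mult t u =
     lin_ext free_scale (\<lambda>(a, b). lin_ext free_scale (\<lambda>(c, d). gen (a * c, b * d)) u) t"

text \<open>Product and unit of the bialgebra are those of the class \<open>ring_1\<close>; the requirement
  \<open>0 \<noteq> 1\<close> of that class is implied by \<open>counit 1 = 1\<close>. The value \<open>\<Delta> x\<close> is a representative
  of the coproduct of \<open>x\<close>.\<close>

locale bialgebra = vector_space smul
  for smul :: "'k::field \<Rightarrow> 'a::ring_1 \<Rightarrow> 'a" +
  fixes \<Delta> :: "'a \<Rightarrow> ('a \<times> 'a \<Rightarrow>\<^sub>0 'k)"
    and counit :: "'a \<Rightarrow> 'k"
  assumes mult_scale_left: "smul c x * y = smul c (x * y)"
    and mult_scale_right: "x * smul c y = smul c (x * y)"
    and coproduct_add: "tensor2_eq smul (\<Delta> (x + y)) (\<Delta> x + \<Delta> y)"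
    and coproduct_scale: "tensor2_eq smul (\<Delta> (smul c x)) (free_scale c (\<Delta> x))"
    and counit_linear: "Vector_Spaces.linear smul (*) counit"
    and coassoc: "tensor3_eq smul
          (lin_ext free_scale (\<lambda>(u, w). lin_ext free_scale (\<lambda>(u1, u2). gen (u1, u2, w)) (\<Delta> u)) (\<Delta> x))
          (lin_ext free_scale (\<lambda>(u, w). lin_ext free_scale (\<lambda>(w1, w2). gen (u, w1, w2)) (\<Delta> w)) (\<Delta> x))"
    and counit_left: "lin_ext smul (\<lambda>(u, w). smul (counit u) w) (\<Delta> x) = x"
    and counit_right: "lin_ext smul (\<lambda>(u, w). smul (counit w) u) (\<Delta> x) = x"
    and coproduct_mult: "tensor2_eq smul (\<Delta> (x * y)) (tensor2_mult (\<Delta> x) (\<Delta> y))"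
    and coproduct_one: "tensor2_eq smul (\<Delta> 1) (gen (1, 1))"
    and counit_mult: "counit (x * y) = counit x * counit y"
    and counit_one: "counit 1 = 1"
begin

definition is_antipode :: "('a \<Rightarrow> 'a) \<Rightarrow> bool" where
  "is_antipode S \<longleftrightarrow> Vector_Spaces.linear smul smul S \<and>
     (\<forall>x. lin_ext smul (\<lambda>(u, w). S u * w) (\<Delta> x) = smul (counit x) 1) \<and>
     (\<forall>x. lin_ext smul (\<lambda>(u, w). u * S w) (\<Delta> x) = smul (counit x) 1)"

end

text \<open>\<open>G m\<close> is the homogeneous component of degree \<open>m\<close>; \<open>direct_sum\<close> states that the whole space
  is the internal direct sum of the components. An antipode exists automatically and is unique.\<close>

locale graded_connected_hopf_algebra = bialgebra smul \<Delta> counit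
  for smul :: "'k::field \<Rightarrow> 'a::ring_1 \<Rightarrow> 'a"
    and \<Delta> :: "'a \<Rightarrow> ('a \<times> 'a \<Rightarrow>\<^sub>0 'k)"
    and counit :: "'a \<Rightarrow> 'k" +
  fixes G :: "nat \<Rightarrow> 'a set"
  assumes component_subspace: "subspace (G m)"
    and direct_sum: "\<exists>!f. (\<forall>m. f m \<in> G m) \<and> finite {m. f m \<noteq> 0} \<and> x = (\<Sum>m | f m \<noteq> 0. f m)"
    and graded_mult: "x \<in> G p \<Longrightarrow> y \<in> G q \<Longrightarrow> x * y \<in> G (p + q)"
    and graded_coproduct: "x \<in> G m \<Longrightarrow>
          \<exists>t. tensor2_eq smul (\<Delta> x) t \<and> Poly_Mapping.keys t \<subseteq> (\<Union>p\<le>m. G p \<times> G (m - p))"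
    and graded_one: "1 \<in> G 0"
    and graded_counit: "m > 0 \<Longrightarrow> x \<in> G m \<Longrightarrow> counit x = 0"
    and connected: "dim (G 0) = 1"

text \<open>Trace of an endomorphism \<open>f\<close> of a finite-dimensional invariant subspace \<open>V\<close>, as the sum of the
  diagonal matrix entries in some basis of \<open>V\<close>.\<close>

definition trace_on :: "('k::field \<Rightarrow> 'a::ab_group_add \<Rightarrow> 'a) \<Rightarrow> 'a set \<Rightarrow> ('a \<Rightarrow> 'a) \<Rightarrow> 'k" where
  "trace_on smul V f =
     (let B = (SOME B. \<not> module.dependent smul B \<and> module.span smul B = V)
      in \<Sum>b\<in>B. module.representation smul B (f b) b)"

text \<open>The reciprocal of a value on the Riemann sphere: \<open>1 / \<infinity> = 0\<close> at a pole.\<close>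

definition recip_value :: "(complex \<Rightarrow> complex) \<Rightarrow> complex \<Rightarrow> complex" where
  "recip_value h z = (if is_pole h z then 0 else 1 / h z)"

end

theory Submission
  imports Defs "HOL-Library.Function_Algebras" "HOL-Real_Asymp.Real_Asymp"
begin

text \<open>Write \<open>h_m\<close> for the dimension of \<open>G m\<close> and \<open>a_m\<close> for the trace of the antipode on it. The
asymptotic formula is singularity analysis applied to the identity
\<open>(\<Sum>a_m z^m) * h z = h (z^2)\<close>, that is
\<open>\<Sum>p\<le>m. h_p * a_(m-p) = (if m is even then h_(m/2) else 0)\<close>.

The identity (\<open>trace_antipode_convolution\<close>) compares traces of two maps on the degree \<open>m\<close> part of
\<open>H \<otimes> H\<close>. The left side is the trace of \<open>id \<otimes> S\<close>, the right side that of the exchange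
\<open>\<tau> (x \<otimes> y) = y \<otimes> x\<close>. Two maps connect them: the bijection \<open>\<phi> (x \<otimes> y) = x_1 \<otimes> x_2 y\<close>
and \<open>T (x \<otimes> y) = x y_1 \<otimes> S y_2\<close>. For a group algebra they send \<open>(x, y)\<close> to \<open>(x, x y)\<close>
and \<open>(x y, y^(-1))\<close>, and \<open>\<phi> T = \<tau> \<phi>\<close>. In general
\<open>\<phi> T - \<tau> \<phi>\<close> maps \<open>x \<otimes> y\<close> to \<open>x_1 y \<otimes> x_2 - x_2 y \<otimes> x_1\<close>, which measures the failure of
cocommutativity. Since every element \<open>x\<close> of the augmentation ideal \<open>I\<close> satisfies
\<open>\<Delta> x = x \<otimes> 1 + 1 \<otimes> x\<close> modulo \<open>I \<otimes> I\<close>, the coproduct is cocommutative to leading order for the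
filtration by powers of \<open>I\<close> (\<open>cop_aug_power_cocommutative\<close>). So the defect raises the
filtration; on a fixed degree the filtration is finite, \<open>T\<close> and \<open>\<phi>^(-1) \<tau> \<phi>\<close> differ by a
nilpotent map, and \<open>T\<close> has the trace of \<open>\<tau>\<close>. On the other hand \<open>T - id \<otimes> S\<close> raises the
degree of the left factor, so \<open>T\<close> also has the trace of \<open>id \<otimes> S\<close>. All these maps are used in their
transposed form, on bilinear forms on \<open>H\<close>: forms are ordinary functions, and a form takes the same
value on all representatives of a tensor.

Since \<open>h_0 = 1\<close>, the identity determines the \<open>a_m\<close> recursively and shows that they are integers.

For the asymptotics, write \<open>h w = g w / (1 - w/R)^\<gamma>\<close> with \<open>g\<close> holomorphic beyond \<open>|w| \<le> R\<close> and
\<open>g R \<noteq> 0\<close>, and let \<open>f\<close> be the reciprocal of \<open>h\<close>, which is holomorphic beyond \<open>|z| \<le> \<surd>R\<close>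
because \<open>h\<close> has no zeros there. Then \<open>\<Sum>a_m z^m = g (z^2) f z / (1 - z^2/R)^\<gamma>\<close>. The
coefficients of \<open>K z = g (z^2) f z\<close> are absolutely summable at \<open>|z| = \<surd>R\<close>, so Tannery's theorem
evaluates the limit of the suitably normalised coefficients of a quotient \<open>K z / (1 - z^2/R)^\<gamma>\<close>:
even indices see the even part of \<open>K\<close> at \<open>\<surd>R\<close>, odd indices the odd part. This produces
\<open>f (\<surd>R) \<plusminus> f (-\<surd>R)\<close>, and the factor \<open>2^(-\<gamma>)\<close> arises from comparing binomial coefficients of
size \<open>(m/2)^(\<gamma>-1)\<close> and \<open>m^(\<gamma>-1)\<close> and from the factor \<open>1/2\<close> in the even and odd parts.\<close>

section \<open>Traces of endomorphisms of finite-dimensional subspaces\<close>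

lemma linear_sum_scale:
  assumes "Vector_Spaces.linear s1 s2 f"
  shows "f (\<Sum>i\<in>I. s1 (c i) (w i)) = (\<Sum>i\<in>I. s2 (c i) (f (w i)))"
proof -
  interpret Vector_Spaces.linear s1 s2 f by fact
  show ?thesis by (simp add: sum scale)
qed

context vector_space
begin

lemma finite_span_obtains_basis:
  assumes "finite A"
  obtains B where "finite B" "independent B" "span B = span A"
proof -
  obtain B where B: "B \<subseteq> span A" "independent B" "span A \<subseteq> span B"
    using maximal_independent_subset[of "span A"] by metis
  moreover from this assms have "finite B"
    using independent_span_bound by blast
  moreover have "span B = span A"
    using B by (meson span_minimal subspace_span subset_antisym)
  ultimately show thesis using that by blast
qed

lemma finite_span_subspace:
  assumes "finite A" "subspace U" "U \<subseteq> span A"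
  obtains B where "finite B" "span B = U"
proof -
  obtain B where B: "B \<subseteq> U" "independent B" "U \<subseteq> span B"
    using maximal_independent_subset[of U] by metis
  then have "finite B" using independent_span_bound[OF assms(1) B(2)] assms(3) by blast
  moreover have "span B = U" using B assms(2) by (meson span_minimal subset_antisym)
  ultimately show thesis using that by blast
qed

lemma trace_on_cong:
  assumes V: "subspace V" and eq: "\<And>x. x \<in> V \<Longrightarrow> f x = g x"
  shows "trace_on scale V f = trace_on scale V g"
proof -
  have "\<exists>B. independent B \<and> span B = V"
    using maximal_independent_subset[of V] V by (metis span_minimal subset_antisym)
  then have "span (SOME B. independent B \<and> span B = V) = V"
    by (metis (mono_tags, lifting) someI_ex)
  then show ?thesis
    using eq span_base unfolding trace_on_def Let_def by (metis (no_types, lifting) sum.cong)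
qed

lemma span_frame:
  assumes "finite J" "\<And>j. j \<in> J \<Longrightarrow> v j \<in> V" "subspace V"
    and expand: "\<And>x. x \<in> V \<Longrightarrow> x = (\<Sum>j\<in>J. scale (l j x) (v j))"
  shows "span (v ` J) = V"
proof
  show "span (v ` J) \<subseteq> V" using assms by (intro span_minimal) auto
  show "V \<subseteq> span (v ` J)"
  proof
    fix x assume "x \<in> V"
    then have "x = (\<Sum>j\<in>J. scale (l j x) (v j))" by (rule expand)
    also have "\<dots> \<in> span (v ` J)"
      by (intro span_sum span_scale span_base) auto
    finally show "x \<in> span (v ` J)" .
  qed
qed

text \<open>Expanding the basis from the definition of the trace in the vectors \<open>v j\<close>, and these in the basis,
gives the same double sum. The functionals are linear on the whole space, which suits evaluations of
bilinear forms at pairs of basis vectors.\<close>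

lemma trace_on_eq_sum_frame:
  assumes J: "finite J" "\<And>j. j \<in> J \<Longrightarrow> v j \<in> V"
    and l: "\<And>j. j \<in> J \<Longrightarrow> Vector_Spaces.linear scale (*) (l j)"
    and expand: "\<And>x. x \<in> V \<Longrightarrow> x = (\<Sum>j\<in>J. scale (l j x) (v j))"
    and V: "subspace V"
    and f: "Vector_Spaces.linear scale scale f" "\<And>x. x \<in> V \<Longrightarrow> f x \<in> V"
  shows "trace_on scale V f = (\<Sum>j\<in>J. l j (f (v j)))"
proof -
  have spanV: "span (v ` J) = V"
    using J V expand by (intro span_frame)
  define C where "C = (SOME B. independent B \<and> span B = V)"
  have "\<exists>B. independent B \<and> span B = V"
    using finite_span_obtains_basis[of "v ` J"] J(1) spanV by (metis finite_imageI)
  then have C: "independent C" "span C = V"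
    unfolding C_def by (metis (mono_tags, lifting) someI_ex)+
  then have finC: "finite C"
    using independent_span_bound[of "v ` J" C] J(1) spanV span_superset by (metis finite_imageI)
  have VC: "x = (\<Sum>b\<in>C. scale (representation C x b) b)" if "x \<in> V" for x
    using sum_representation_eq[OF C(1), of x C] that C(2) finC by simp
  have flin: "f (\<Sum>j\<in>J. scale (c j) (w j)) = (\<Sum>j\<in>J. scale (c j) (f (w j)))" for c w
    using f(1) by (rule linear_sum_scale)
  have llin: "l j (\<Sum>b\<in>C. scale (c b) b) = (\<Sum>b\<in>C. c b * l j b)" if "j \<in> J" for j c
    using l[OF that] by (rule linear_sum_scale)
  have rlin: "representation C (\<Sum>j\<in>J. scale (c j) (w j)) b = (\<Sum>j\<in>J. c j * representation C (w j) b)"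
    if "\<And>j. j \<in> J \<Longrightarrow> w j \<in> V" for c w b
    using that C by (subst representation_sum) (auto simp: representation_scale span_scale)
  have "trace_on scale V f = (\<Sum>b\<in>C. representation C (f b) b)"
    by (simp add: trace_on_def Let_def C_def)
  also have "\<dots> = (\<Sum>b\<in>C. \<Sum>j\<in>J. l j b * representation C (f (v j)) b)"
  proof (rule sum.cong[OF refl])
    fix b assume b: "b \<in> C"
    then have "b \<in> V" using C(2) span_base by blast
    then have "f b = (\<Sum>j\<in>J. scale (l j b) (f (v j)))"
      using expand[of b] flin by metis
    then show "representation C (f b) b = (\<Sum>j\<in>J. l j b * representation C (f (v j)) b)"
      using rlin[of "\<lambda>j. f (v j)" "\<lambda>j. l j b" b] J(2) f(2) by simp
  qed
  also have "\<dots> = (\<Sum>j\<in>J. \<Sum>b\<in>C. representation C (f (v j)) b * l j b)"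
    by (subst sum.swap) (simp add: mult.commute)
  also have "\<dots> = (\<Sum>j\<in>J. l j (f (v j)))"
  proof (rule sum.cong[OF refl])
    fix j assume j: "j \<in> J"
    have "l j (f (v j)) = l j (\<Sum>b\<in>C. scale (representation C (f (v j)) b) b)"
      using VC[of "f (v j)"] f(2) J(2)[OF j] by simp
    then show "(\<Sum>b\<in>C. representation C (f (v j)) b * l j b) = l j (f (v j))"
      using llin[OF j] by simp
  qed
  finally show ?thesis .
qed

lemma trace_on_eq_sum_basis:
  assumes B: "finite B" "independent B" "span B = V"
    and f: "Vector_Spaces.linear scale scale f" "\<And>x. x \<in> V \<Longrightarrow> f x \<in> V"
  shows "trace_on scale V f = (\<Sum>b\<in>B. representation B (f b) b)"
proof -
  \<comment> \<open>The coordinates are linear on \<open>span B\<close> only, so they are extended to the whole space.\<close>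
  define E where "E = extend_basis B"
  have E: "B \<subseteq> E" "independent E" "span E = UNIV"
    using extend_basis_superset[OF B(2)] independent_extend_basis[OF B(2)]
      span_extend_basis[OF B(2)] by (simp_all add: E_def)
  have rep: "representation E x = representation B x" if "x \<in> V" for x
    using representation_extend[OF E(2) _ E(1)] that B(3) by blast
  have "trace_on scale V f = (\<Sum>b\<in>B. representation E (f b) b)"
  proof (rule trace_on_eq_sum_frame[where v = "\<lambda>b. b"])
    show "Vector_Spaces.linear scale (*) (\<lambda>x. representation E x b)" for b
      using E by (auto simp: Vector_Spaces.linear_iff representation_add representation_scale
          intro!: vector_space_axioms vector_space_over_itself.vector_space_axioms)
    show "x = (\<Sum>b\<in>B. scale (representation E x b) b)" if "x \<in> V" for x
      using sum_representation_eq[OF B(2), of x B] that B(1,3) rep[OF that] by simp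
  qed (use B f span_base subspace_span in blast)+
  also have "\<dots> = (\<Sum>b\<in>B. representation B (f b) b)"
    using rep f(2) B(3) span_base by (intro sum.cong) auto
  finally show ?thesis .
qed

text \<open>In a basis of \<open>V\<close> that extends one of \<open>U\<close>, the additional basis vectors contribute no diagonal
entries.\<close>

lemma trace_on_eq_trace_on_range:
  assumes V: "finite A" "span A = V" and U: "subspace U" "U \<subseteq> V"
    and f: "Vector_Spaces.linear scale scale f" "\<And>x. x \<in> V \<Longrightarrow> f x \<in> U"
  shows "trace_on scale V f = trace_on scale U f"
proof -
  obtain B where B: "B \<subseteq> U" "independent B" "U \<subseteq> span B"
    using maximal_independent_subset[of U] by metis
  then have spanB: "span B = U"
    using U(1) by (meson span_minimal subset_antisym)
  have "B \<subseteq> V" using B U by blast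
  then obtain C where C: "B \<subseteq> C" "C \<subseteq> V" "independent C" "V \<subseteq> span C"
    using maximal_independent_subset_extend[of B V] B(2) by metis
  have spanC: "span C = V"
    using C V by (metis span_minimal subset_antisym subspace_span)
  have finC: "finite C"
    using independent_span_bound[OF V(1) C(3)] C(2) V(2) by blast
  then have finB: "finite B" using C(1) finite_subset by blast
  have rep: "representation C (f x) = representation B (f x)" if "x \<in> V" for x
    using representation_extend[OF C(3) _ C(1)] f(2)[OF that] spanB by blast
  have "trace_on scale V f = (\<Sum>b\<in>C. representation C (f b) b)"
    using trace_on_eq_sum_basis[OF finC C(3) spanC f(1)] f(2) U(2) by blast
  also have "\<dots> = (\<Sum>b\<in>C. representation B (f b) b)"
    using rep C(2) by (intro sum.cong) auto
  also have "\<dots> = (\<Sum>b\<in>B. representation B (f b) b)"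
    using finC C(1) representation_ne_zero by (intro sum.mono_neutral_right) blast+
  also have "\<dots> = trace_on scale U f"
    using trace_on_eq_sum_basis[OF finB B(2) spanB f(1)] f(2) U(2) by fastforce
  finally show ?thesis .
qed

lemma trace_on_add:
  assumes V: "finite A" "span A = V"
    and f: "Vector_Spaces.linear scale scale f" "\<And>x. x \<in> V \<Longrightarrow> f x \<in> V"
    and g: "Vector_Spaces.linear scale scale g" "\<And>x. x \<in> V \<Longrightarrow> g x \<in> V"
  shows "trace_on scale V (\<lambda>x. f x + g x) = trace_on scale V f + trace_on scale V g"
proof -
  obtain B where B: "finite B" "independent B" "span B = V"
    using finite_span_obtains_basis V by metis
  have sum_lin: "Vector_Spaces.linear scale scale (\<lambda>x. f x + g x)"
    using f(1) g(1) by (simp add: Vector_Spaces.linear_iff scale_right_distrib)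
  have sum_in: "f x + g x \<in> V" if "x \<in> V" for x
    using f(2)[OF that] g(2)[OF that] B(3) span_add by blast
  have tr: "trace_on scale V f = (\<Sum>b\<in>B. representation B (f b) b)"
      "trace_on scale V g = (\<Sum>b\<in>B. representation B (g b) b)"
      "trace_on scale V (\<lambda>x. f x + g x) = (\<Sum>b\<in>B. representation B (f b + g b) b)"
    using trace_on_eq_sum_basis[OF B f(1)] trace_on_eq_sum_basis[OF B g(1)]
      trace_on_eq_sum_basis[OF B sum_lin] f(2) g(2) sum_in by blast+
  have BV: "b \<in> V" if "b \<in> B" for b using that B(3) span_base by blast
  show ?thesis
    unfolding tr sum.distrib[symmetric]
    using f(2)[folded B(3)] g(2)[folded B(3)] BV[folded B(3)] B(2)
    by (intro sum.cong) (auto simp: representation_add)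
qed

lemma trace_on_compose_commute:
  assumes V: "finite A" "span A = V"
    and f: "Vector_Spaces.linear scale scale f" "\<And>x. x \<in> V \<Longrightarrow> f x \<in> V"
    and g: "Vector_Spaces.linear scale scale g" "\<And>x. x \<in> V \<Longrightarrow> g x \<in> V"
  shows "trace_on scale V (\<lambda>x. f (g x)) = trace_on scale V (\<lambda>x. g (f x))"
proof -
  obtain B where B: "finite B" "independent B" "span B = V"
    using finite_span_obtains_basis V by metis
  have BV: "b \<in> V" if "b \<in> B" for b using that B(3) span_base by blast
  have expand: "representation B (f (g b)) b =
      (\<Sum>c\<in>B. representation B (g b) c * representation B (f c) b)"
    if f: "Vector_Spaces.linear scale scale f" "\<And>x. x \<in> V \<Longrightarrow> f x \<in> V"
      and g: "\<And>x. x \<in> V \<Longrightarrow> g x \<in> V" and b: "b \<in> B" for f g b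
  proof -
    have "f (g b) = f (\<Sum>c\<in>B. scale (representation B (g b) c) c)"
      using sum_representation_eq[OF B(2), of "g b" B] g BV[OF b] B by simp
    also have "\<dots> = (\<Sum>c\<in>B. scale (representation B (g b) c) (f c))"
      by (rule linear_sum_scale[OF f(1)])
    finally have fgb: "f (g b) = \<dots>" .
    show ?thesis
      unfolding fgb using B(1,2) f(2)[folded B(3)] BV[folded B(3)]
      by (simp add: representation_sum representation_scale span_scale)
  qed
  have lin: "Vector_Spaces.linear scale scale (\<lambda>x. f (g x))"
      "Vector_Spaces.linear scale scale (\<lambda>x. g (f x))"
    using f(1) g(1) by (simp_all add: Vector_Spaces.linear_iff)
  have "trace_on scale V (\<lambda>x. f (g x)) =
      (\<Sum>b\<in>B. \<Sum>c\<in>B. representation B (g b) c * representation B (f c) b)"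
  proof -
    have "representation B (f (g b)) b =
        (\<Sum>c\<in>B. representation B (g b) c * representation B (f c) b)" if "b \<in> B" for b
      using that f g(2) by (intro expand)
    then show ?thesis using f(2) g(2) by (simp add: trace_on_eq_sum_basis[OF B lin(1)])
  qed
  also have "\<dots> = (\<Sum>c\<in>B. \<Sum>b\<in>B. representation B (f c) b * representation B (g b) c)"
    by (subst sum.swap) (simp add: mult.commute)
  also have "\<dots> = trace_on scale V (\<lambda>x. g (f x))"
  proof -
    have "representation B (g (f b)) b =
        (\<Sum>c\<in>B. representation B (f b) c * representation B (g c) b)" if "b \<in> B" for b
      using that g f(2) by (intro expand)
    then show ?thesis using f(2) g(2) by (simp add: trace_on_eq_sum_basis[OF B lin(2)])
  qed
  finally show ?thesis .
qed

text \<open>This is how nilpotent maps enter: each step of the flag has the same trace as the step below it.\<close>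

lemma trace_on_lowering_filtration:
  assumes V: "finite A" "span A = F n"
    and F: "\<And>i. subspace (F i)" "\<And>i. F i \<subseteq> F (Suc i)" "F 0 = {0}"
    and f: "Vector_Spaces.linear scale scale f"
      "\<And>i x. i < n \<Longrightarrow> x \<in> F (Suc i) \<Longrightarrow> f x \<in> F i"
  shows "trace_on scale (F n) f = 0"
proof -
  have fin: "\<exists>A. finite A \<and> span A = F i" if "i \<le> n" for i
    using finite_span_subspace[OF V(1) F(1)] lift_Suc_mono_le[of F, OF F(2) that] V(2) by metis
  have "i \<le> n \<Longrightarrow> trace_on scale (F i) f = 0" for i
  proof (induction i)
    case 0
    have "finite {}" "independent {}" "span {} = F 0" using F(3) by (simp_all add: independent_empty)
    moreover have "f x \<in> F 0" if "x \<in> F 0" for x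
      using that module_hom.zero[OF f(1)[unfolded Vector_Spaces.linear_iff_module_hom]] F(3) by simp
    ultimately show ?case
      using trace_on_eq_sum_basis[OF _ _ _ f(1)] by (metis sum.empty)
  next
    case (Suc i)
    then obtain A' where "finite A'" "span A' = F (Suc i)" using fin by blast
    then have "trace_on scale (F (Suc i)) f = trace_on scale (F i) f"
      using F f Suc.prems by (intro trace_on_eq_trace_on_range) auto
    then show ?case using Suc by simp
  qed
  then show ?thesis by simp
qed

lemma linear_inj_on_finite_span_imp_surj:
  assumes V: "finite A" "span A = V"
    and f: "Vector_Spaces.linear scale scale f" "\<And>x. x \<in> V \<Longrightarrow> f x \<in> V" "inj_on f V"
  shows "f ` V = V"
proof -
  obtain B where B: "finite B" "independent B" "span B = V"
    using finite_span_obtains_basis V by metis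
  interpret f: Vector_Spaces.linear scale scale f by (rule f(1))
  have ind: "independent (f ` B)"
    using f.independent_injective_image[OF B(2)] f(3) B(3) by simp
  have sub: "f ` B \<subseteq> span B" using f(2) B(3) span_base by blast
  have subV: "f ` B \<subseteq> V" using sub B(3) by simp
  obtain C where C: "f ` B \<subseteq> C" "C \<subseteq> V" "independent C" "V \<subseteq> span C"
    using maximal_independent_subset_extend[OF subV ind] by metis
  have finC: "finite C" "card C \<le> card B"
    using independent_span_bound[OF B(1) C(3)] C(2) B(3) by auto
  have "card (f ` B) = card B"
    using f(3) B(3) by (metis card_image inj_on_subset span_superset)
  then have "f ` B = C" using C(1) finC by (metis card_mono card_subset_eq le_antisym)
  then have "span (f ` B) = V"
    using C(4) sub B(3) by (metis span_minimal subset_antisym subspace_span)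
  then show ?thesis using f.span_image[of B] B(3) by simp
qed

end

section \<open>Forms evaluated on coproducts\<close>

context vector_space
begin

lemma lin_ext_superset:
  assumes "finite K" "Poly_Mapping.keys t \<subseteq> K"
  shows "lin_ext scale g t = (\<Sum>i\<in>K. scale (Poly_Mapping.lookup t i) (g i))"
  unfolding lin_ext_def using assms
  by (intro sum.mono_neutral_left) (auto simp: in_keys_iff)

lemma lin_ext_add: "lin_ext scale g (t + u) = lin_ext scale g t + lin_ext scale g u"
proof -
  let ?K = "Poly_Mapping.keys t \<union> Poly_Mapping.keys u"
  have "Poly_Mapping.keys (t + u) \<subseteq> ?K" by (rule Poly_Mapping.keys_add)
  then show ?thesis
    by (simp add: lin_ext_superset[of ?K] lookup_add scale_left_distrib sum.distrib)
qed

lemma lin_ext_free_scale: "lin_ext scale g (free_scale c t) = scale c (lin_ext scale g t)"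
proof -
  have "Poly_Mapping.keys (free_scale c t) \<subseteq> Poly_Mapping.keys t"
    by (auto simp: in_keys_iff)
  then show ?thesis
    by (simp add: lin_ext_superset[of "Poly_Mapping.keys t"] scale_sum_right)
qed

lemma lin_ext_gen: "lin_ext scale g (gen i) = g i"
  by (simp add: lin_ext_def gen_def)

lemma linear_lin_ext: "Vector_Spaces.linear free_scale scale (lin_ext scale g)"
  using vector_space_axioms vector_space_free_scale
  by (simp add: Vector_Spaces.linear_iff lin_ext_add lin_ext_free_scale)

lemma lin_ext_diff: "lin_ext scale g (t - u) = lin_ext scale g t - lin_ext scale g u"
  using lin_ext_add[of g "t - u" u] by simp

lemma lin_ext_lin_ext:
  "lin_ext scale g (lin_ext free_scale F t) = lin_ext scale (\<lambda>i. lin_ext scale g (F i)) t"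
  unfolding lin_ext_def[of free_scale F t] lin_ext_def[of scale _ t]
  by (rule linear_sum_scale[OF linear_lin_ext])

text \<open>The universal property of the tensor powers: a multilinear map is well defined on classes of
representatives.\<close>

lemma lin_ext_multilinear_relations:
  assumes "vector_space smul"
    and "\<And>f. f \<in> slots \<Longrightarrow> Vector_Spaces.linear smul scale (\<lambda>x. g (f x))"
    and "t \<in> multilinear_relations smul slots"
  shows "lin_ext scale g t = 0"
proof -
  interpret L: Vector_Spaces.linear free_scale scale "lin_ext scale g" by (rule linear_lin_ext)
  show ?thesis
    using assms(3) unfolding multilinear_relations_def
  proof (rule L.eq_0_on_span[rotated])
    fix r assume "r \<in> {gen (f (x + y)) - (gen (f x) + gen (f y)) | f x y. f \<in> slots} \<union>
        {gen (f (smul c x)) - free_scale c (gen (f x)) | f c x. f \<in> slots}"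
    then show "lin_ext scale g r = 0"
      using assms(2)
      by (auto simp: lin_ext_diff lin_ext_add lin_ext_free_scale lin_ext_gen Vector_Spaces.linear_iff)
  qed
qed

lemma tensor2_eq_imp_lin_ext_eq:
  assumes "tensor2_eq smul t u" "vector_space smul"
    and "\<And>y. Vector_Spaces.linear smul scale (\<lambda>x. g (x, y))"
    and "\<And>x. Vector_Spaces.linear smul scale (\<lambda>y. g (x, y))"
  shows "lin_ext scale g t = lin_ext scale g u"
proof -
  have "lin_ext scale g (t - u) = 0"
    using assms(1)[unfolded tensor2_eq_def]
    by (rule lin_ext_multilinear_relations[OF assms(2), rotated]) (use assms(3,4) in auto)
  then show ?thesis by (simp add: lin_ext_diff)
qed

lemma tensor3_eq_imp_lin_ext_eq:
  assumes "tensor3_eq smul t u" "vector_space smul"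
    and "\<And>y z. Vector_Spaces.linear smul scale (\<lambda>x. g (x, y, z))"
    and "\<And>x z. Vector_Spaces.linear smul scale (\<lambda>y. g (x, y, z))"
    and "\<And>x y. Vector_Spaces.linear smul scale (\<lambda>z. g (x, y, z))"
  shows "lin_ext scale g t = lin_ext scale g u"
proof -
  have "lin_ext scale g (t - u) = 0"
    using assms(1)[unfolded tensor3_eq_def]
    by (rule lin_ext_multilinear_relations[OF assms(2), rotated]) (use assms(3-5) in auto)
  then show ?thesis by (simp add: lin_ext_diff)
qed

end

lemma lin_ext_linear_image:
  assumes "Vector_Spaces.linear s1 s2 f"
  shows "lin_ext s2 (\<lambda>i. f (g i)) t = f (lin_ext s1 g t)"
  unfolding lin_ext_def by (rule linear_sum_scale[OF assms, symmetric])

context bialgebra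
begin

definition functional :: "('a \<Rightarrow> 'k) \<Rightarrow> bool" where
  "functional f \<longleftrightarrow> (\<forall>x y. f (x + y) = f x + f y) \<and> (\<forall>c x. f (smul c x) = c * f x)"

definition bilin :: "('a \<Rightarrow> 'a \<Rightarrow> 'k) \<Rightarrow> bool" where
  "bilin \<beta> \<longleftrightarrow> (\<forall>x x' y. \<beta> (x + x') y = \<beta> x y + \<beta> x' y) \<and> (\<forall>c x y. \<beta> (smul c x) y = c * \<beta> x y) \<and>
     (\<forall>x y y'. \<beta> x (y + y') = \<beta> x y + \<beta> x y') \<and> (\<forall>c x y. \<beta> x (smul c y) = c * \<beta> x y)"

text \<open>In Sweedler notation this is \<open>\<beta> (x_1, x_2)\<close>. All identities between tensors are tested
against such forms; for bilinear \<open>\<beta>\<close> the value does not depend on the representative \<open>\<Delta> x\<close>.\<close>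

definition cop :: "('a \<Rightarrow> 'a \<Rightarrow> 'k) \<Rightarrow> 'a \<Rightarrow> 'k" where
  "cop \<beta> x = lin_ext (*) (\<lambda>(u, w). \<beta> u w) (\<Delta> x)"

lemma functional_iff: "functional f \<longleftrightarrow> Vector_Spaces.linear smul (*) f"
  by (auto simp: functional_def Vector_Spaces.linear_iff vector_space_axioms
      intro: vector_space_over_itself.vector_space_axioms)

lemma bilin_iff: "bilin \<beta> \<longleftrightarrow> (\<forall>y. functional (\<lambda>x. \<beta> x y)) \<and> (\<forall>x. functional (\<beta> x))"
  unfolding bilin_def functional_def by blast

lemma counit_add: "counit (x + y) = counit x + counit y"
  and counit_scale: "counit (smul c x) = c * counit x"
  using counit_linear by (auto simp: Vector_Spaces.linear_iff)

lemma functional_counit: "functional counit"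
  by (simp add: functional_def counit_add counit_scale)

lemma functional_0: "functional f \<Longrightarrow> f 0 = 0"
  unfolding functional_def by (metis add_cancel_right_right)

lemma functional_diff: "functional f \<Longrightarrow> f (x - y) = f x - f y"
  unfolding functional_def by (metis add_diff_cancel diff_add_cancel)

lemma functional_sum: "functional f \<Longrightarrow> f (\<Sum>i\<in>I. g i) = (\<Sum>i\<in>I. f (g i))"
  using module_hom.sum[of smul "(*)" f] by (simp add: functional_iff Vector_Spaces.linear_iff_module_hom)

lemma cop_sum: "cop \<beta> x = (\<Sum>(u, w)\<in>Poly_Mapping.keys (\<Delta> x). Poly_Mapping.lookup (\<Delta> x) (u, w) * \<beta> u w)"
  by (simp add: cop_def lin_ext_def case_prod_unfold)

lemma cop_add_form: "cop (\<lambda>u w. \<beta> u w + \<gamma> u w) x = cop \<beta> x + cop \<gamma> x"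
  by (simp add: cop_sum case_prod_unfold distrib_left sum.distrib)

lemma cop_diff_form: "cop (\<lambda>u w. \<beta> u w - \<gamma> u w) x = cop \<beta> x - cop \<gamma> x"
  by (simp add: cop_sum case_prod_unfold right_diff_distrib sum_subtractf)

lemma cop_scale_form: "cop (\<lambda>u w. c * \<beta> u w) x = c * cop \<beta> x"
  by (simp add: cop_sum case_prod_unfold sum_distrib_left mult.left_commute)

lemma cop_zero_form: "cop (\<lambda>u w. 0) x = 0"
  by (simp add: cop_sum)

lemma cop_swap: "cop (\<lambda>a b. cop (\<lambda>c d. K a b c d) y) x = cop (\<lambda>c d. cop (\<lambda>a b. K a b c d) x) y"
  unfolding cop_sum case_prod_unfold sum_distrib_left
  by (subst sum.swap) (simp add: mult.left_commute)

lemma cop_tensor2_eq: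
  assumes "bilin \<beta>" "tensor2_eq smul (\<Delta> x) t"
  shows "cop \<beta> x = lin_ext (*) (\<lambda>(u, w). \<beta> u w) t"
  unfolding cop_def using assms
  by (intro vector_space_over_itself.tensor2_eq_imp_lin_ext_eq[OF _ vector_space_axioms])
     (auto simp: bilin_iff functional_iff)

lemma cop_add:
  assumes "bilin \<beta>"
  shows "cop \<beta> (x + y) = cop \<beta> x + cop \<beta> y"
  using cop_tensor2_eq[OF assms coproduct_add]
  by (simp add: vector_space_over_itself.lin_ext_add cop_def)

lemma cop_scale:
  assumes "bilin \<beta>"
  shows "cop \<beta> (smul c x) = c * cop \<beta> x"
  using cop_tensor2_eq[OF assms coproduct_scale]
  by (simp add: vector_space_over_itself.lin_ext_free_scale cop_def)

lemma functional_cop: "bilin \<beta> \<Longrightarrow> functional (cop \<beta>)"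
  by (simp add: functional_def cop_add cop_scale)

lemma cop_mult:
  assumes "bilin \<beta>"
  shows "cop \<beta> (x * y) = cop (\<lambda>a b. cop (\<lambda>c d. \<beta> (a * c) (b * d)) y) x"
proof -
  have "cop \<beta> (x * y) = lin_ext (*) (\<lambda>(u, w). \<beta> u w) (tensor2_mult (\<Delta> x) (\<Delta> y))"
    by (rule cop_tensor2_eq[OF assms coproduct_mult])
  also have "\<dots> = cop (\<lambda>a b. cop (\<lambda>c d. \<beta> (a * c) (b * d)) y) x"
    by (simp add: tensor2_mult_def cop_def vector_space_over_itself.lin_ext_lin_ext
        vector_space_over_itself.lin_ext_gen case_prod_unfold)
  finally show ?thesis .
qed

lemma cop_coassoc:
  assumes "\<And>b c. functional (\<lambda>a. \<theta> a b c)" "\<And>a c. functional (\<lambda>b. \<theta> a b c)"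
    "\<And>a b. functional (\<lambda>c. \<theta> a b c)"
  shows "cop (\<lambda>u w. cop (\<lambda>a b. \<theta> a b w) u) x = cop (\<lambda>u w. cop (\<lambda>b c. \<theta> u b c) w) x"
proof -
  have "lin_ext (*) (\<lambda>(a, b, c). \<theta> a b c)
      (lin_ext free_scale (\<lambda>(u, w). lin_ext free_scale (\<lambda>(u1, u2). gen (u1, u2, w)) (\<Delta> u)) (\<Delta> x)) =
    lin_ext (*) (\<lambda>(a, b, c). \<theta> a b c)
      (lin_ext free_scale (\<lambda>(u, w). lin_ext free_scale (\<lambda>(w1, w2). gen (u, w1, w2)) (\<Delta> w)) (\<Delta> x))"
    using assms
    by (intro vector_space_over_itself.tensor3_eq_imp_lin_ext_eq[OF coassoc vector_space_axioms])
       (simp_all add: functional_iff)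
  then show ?thesis
    by (simp add: cop_def vector_space_over_itself.lin_ext_lin_ext
        vector_space_over_itself.lin_ext_gen case_prod_unfold)
qed

lemma cop_counit_left:
  assumes "functional f"
  shows "cop (\<lambda>u w. counit u * f w) x = f x"
proof -
  have "cop (\<lambda>u w. counit u * f w) x = lin_ext (*) (\<lambda>p. f (smul (counit (fst p)) (snd p))) (\<Delta> x)"
    using assms by (simp add: cop_def functional_def case_prod_unfold)
  also have "\<dots> = f (lin_ext smul (\<lambda>p. smul (counit (fst p)) (snd p)) (\<Delta> x))"
    using assms by (intro lin_ext_linear_image) (simp add: functional_iff)
  also have "\<dots> = f x" using counit_left[of x] by (simp add: case_prod_unfold)
  finally show ?thesis .
qed

lemma cop_counit_right:
  assumes "functional f"
  shows "cop (\<lambda>u w. counit w * f u) x = f x"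
proof -
  have "cop (\<lambda>u w. counit w * f u) x = lin_ext (*) (\<lambda>p. f (smul (counit (snd p)) (fst p))) (\<Delta> x)"
    using assms by (simp add: cop_def functional_def case_prod_unfold)
  also have "\<dots> = f (lin_ext smul (\<lambda>p. smul (counit (snd p)) (fst p)) (\<Delta> x))"
    using assms by (intro lin_ext_linear_image) (simp add: functional_iff)
  also have "\<dots> = f x" using counit_right[of x] by (simp add: case_prod_unfold)
  finally show ?thesis .
qed

lemma cop_antipode_right:
  assumes "is_antipode S" "functional f"
  shows "cop (\<lambda>u w. f (u * S w)) x = counit x * f 1"
proof -
  have "cop (\<lambda>u w. f (u * S w)) x = f (lin_ext smul (\<lambda>p. fst p * S (snd p)) (\<Delta> x))"
    unfolding cop_def case_prod_unfold
    using assms by (intro lin_ext_linear_image) (simp add: functional_iff)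
  also have "\<dots> = f (smul (counit x) 1)"
    using assms(1) by (simp add: is_antipode_def case_prod_unfold)
  finally show ?thesis using assms(2) by (simp add: functional_def)
qed

lemma antipode_add: "is_antipode S \<Longrightarrow> S (x + y) = S x + S y"
  and antipode_scale: "is_antipode S \<Longrightarrow> S (smul c x) = smul c (S x)"
  by (auto simp: is_antipode_def Vector_Spaces.linear_iff)

end

section \<open>Powers of the augmentation ideal\<close>

context bialgebra
begin

lemma functional_eq_on_span:
  assumes "functional f" "functional g" "x \<in> span A" "\<And>a. a \<in> A \<Longrightarrow> f a = g a"
  shows "f x = g x"
proof -
  have "subspace {x. f x = g x}"
    using functional_0[OF assms(1)] functional_0[OF assms(2)] assms(1,2)
    by (auto simp: subspace_def functional_def)
  then show ?thesis
    using span_induct[OF assms(3), of "\<lambda>x. f x = g x"] assms(4) by simp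
qed

lemma functional_zero_on_span:
  assumes "functional f" "x \<in> span A" "\<And>a. a \<in> A \<Longrightarrow> f a = 0"
  shows "f x = 0"
  using functional_eq_on_span[of f "\<lambda>_. 0" x A] assms by (simp add: functional_def)

lemma mult_in_span:
  assumes "x \<in> span A" "y \<in> span B" "\<And>a b. a \<in> A \<Longrightarrow> b \<in> B \<Longrightarrow> a * b \<in> span C"
  shows "x * y \<in> span C"
proof -
  have "a * y \<in> span C" if "a \<in> A" for a
    using assms(2)
  proof (induction rule: span_induct)
    case base
    show ?case by (auto simp: subspace_def distrib_left mult_scale_right span_add span_scale span_zero)
  qed (use assms(3) that in blast)
  moreover have "subspace {x. x * y \<in> span C}"
    by (auto simp: subspace_def distrib_right mult_scale_left span_add span_scale span_zero)
  ultimately show ?thesis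
    using span_induct[OF assms(1), of "\<lambda>x. x * y \<in> span C"] by blast
qed

text \<open>The powers \<open>I^n\<close> of the augmentation ideal \<open>I\<close>, the kernel of the counit.\<close>

primrec aug_power :: "nat \<Rightarrow> 'a set" where
  "aug_power 0 = UNIV"
| "aug_power (Suc n) = span {x * y | x y. counit x = 0 \<and> y \<in> aug_power n}"

text \<open>The forms that vanish on the \<open>n\<close>-th step \<open>\<Sum>i+j=n. I^i \<otimes> I^j\<close> of the induced filtration of
\<open>H \<otimes> H\<close>.\<close>

definition kills_order :: "nat \<Rightarrow> ('a \<Rightarrow> 'a \<Rightarrow> 'k) \<Rightarrow> bool" where
  "kills_order n \<beta> \<longleftrightarrow>
     (\<forall>i j x y. n \<le> i + j \<longrightarrow> x \<in> aug_power i \<longrightarrow> y \<in> aug_power j \<longrightarrow> \<beta> x y = 0)"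

lemma aug_power_Suc_mult: "counit x = 0 \<Longrightarrow> y \<in> aug_power n \<Longrightarrow> x * y \<in> aug_power (Suc n)"
  by (auto intro!: span_base)

lemma counit_zero_in_aug_power: "counit x = 0 \<Longrightarrow> x \<in> aug_power 1"
  using aug_power_Suc_mult[of x 1 0] by simp

lemma aug_power_left_ideal:
  assumes "y \<in> aug_power n"
  shows "x * y \<in> aug_power n"
proof (cases n)
  case (Suc k)
  have "subspace {y. x * y \<in> aug_power n}"
    by (auto simp: Suc subspace_def distrib_left mult_scale_right span_add span_scale span_zero)
  moreover have "x * (a * b) \<in> aug_power n" if "counit a = 0" "b \<in> aug_power k" for a b
    using aug_power_Suc_mult[of "x * a" b k] that by (simp add: Suc counit_mult mult.assoc)
  ultimately show ?thesis
    using span_induct[of y "{a * b | a b. counit a = 0 \<and> b \<in> aug_power k}" "\<lambda>y. x * y \<in> aug_power n"] assms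
    by (auto simp: Suc)
qed simp

lemma aug_power_mult:
  "x \<in> aug_power i \<Longrightarrow> y \<in> aug_power j \<Longrightarrow> x * y \<in> aug_power (i + j)"
proof (induction i arbitrary: x)
  case (Suc i)
  have "subspace {x. x * y \<in> aug_power (Suc i + j)}"
    by (auto simp: subspace_def distrib_right mult_scale_left span_add span_scale span_zero)
  moreover have "(a * b) * y \<in> aug_power (Suc i + j)" if "counit a = 0" "b \<in> aug_power i" for a b
    using aug_power_Suc_mult[OF that(1) Suc.IH[OF that(2) Suc.prems(2)]] by (simp add: mult.assoc)
  ultimately show ?case
    using span_induct[of x "{a * b | a b. counit a = 0 \<and> b \<in> aug_power i}"
        "\<lambda>x. x * y \<in> aug_power (Suc i + j)"] Suc.prems
    by auto
qed (simp add: aug_power_left_ideal)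

text \<open>This expresses \<open>\<Delta> x = x \<otimes> 1 + 1 \<otimes> x - \<epsilon>(x) (1 \<otimes> 1)\<close> modulo \<open>I \<otimes> I\<close>. It holds because
\<open>u = \<epsilon>(u) 1\<close> modulo \<open>I\<close> in both tensor factors, combined with the counit axioms.\<close>

lemma cop_eq_of_kills_augmentation:
  assumes "bilin \<beta>" and kill: "\<And>u w. counit u = 0 \<Longrightarrow> counit w = 0 \<Longrightarrow> \<beta> u w = 0"
  shows "cop \<beta> x = \<beta> 1 x + \<beta> x 1 - counit x * \<beta> 1 1"
proof -
  have fnl: "functional (\<lambda>u. \<beta> u w)" "functional (\<beta> u)" for u w
    using assms(1) by (auto simp: bilin_iff)
  have expand: "\<beta> u w = counit u * \<beta> 1 w + counit w * \<beta> u 1 - counit u * (counit w * \<beta> 1 1)" for u w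
  proof -
    have eps: "counit (z - smul (counit z) 1) = 0" for z
      using functional_diff[OF functional_counit] by (simp add: counit_scale counit_one)
    have scale_form: "\<beta> (smul c y) z = c * \<beta> y z" "\<beta> y (smul c z) = c * \<beta> y z" for c y z
      using assms(1) by (auto simp: bilin_def)
    have "0 = \<beta> (u - smul (counit u) 1) (w - smul (counit w) 1)"
      using kill eps by simp
    also have "\<dots> = \<beta> u w - counit u * \<beta> 1 w - (counit w * \<beta> u 1 - counit u * (counit w * \<beta> 1 1))"
      unfolding functional_diff[OF fnl(1)] functional_diff[OF fnl(2)] scale_form
      by (simp add: right_diff_distrib)
    finally show ?thesis by (simp add: algebra_simps)
  qed
  have "cop \<beta> x = cop (\<lambda>u w. counit u * \<beta> 1 w + counit w * \<beta> u 1 - counit u * (counit w * \<beta> 1 1)) x"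
    by (rule arg_cong[of _ _ "\<lambda>b. cop b x"], intro ext, rule expand)
  also have "\<dots> = \<beta> 1 x + \<beta> x 1 - counit x * \<beta> 1 1"
    using fnl functional_counit
    by (simp add: cop_add_form cop_diff_form cop_counit_left cop_counit_right functional_def
        distrib_right)
  finally show ?thesis .
qed

lemma bilin_swap: "bilin \<beta> \<Longrightarrow> bilin (\<lambda>x y. \<beta> y x)"
  by (auto simp: bilin_def)

lemma bilin_mult: "bilin \<beta> \<Longrightarrow> bilin (\<lambda>c d. \<beta> (a * c) (b * d))"
  by (auto simp: bilin_def distrib_left mult_scale_right)

lemma bilin_mult_cop: "bilin \<beta> \<Longrightarrow> bilin (\<lambda>a b. cop (\<lambda>c d. \<beta> (a * c) (b * d)) y)"
  by (simp add: bilin_def distrib_right mult_scale_left cop_add_form cop_scale_form)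

text \<open>The coproduct respects the filtrations. Generators \<open>a * b\<close> of \<open>I^(n+1)\<close> are treated by
multiplicativity of the coproduct: \<open>\<Delta> a\<close> contributes filtration degree one and \<open>\<Delta> b\<close> degree
\<open>n\<close>.\<close>

lemma cop_aug_power_eq_0:
  "x \<in> aug_power n \<Longrightarrow> bilin \<beta> \<Longrightarrow> kills_order n \<beta> \<Longrightarrow> cop \<beta> x = 0"
proof (induction n arbitrary: x \<beta>)
  case 0
  then have "\<beta> = (\<lambda>u w. 0)"
    unfolding kills_order_def by (intro ext) (metis UNIV_I aug_power.simps(1) zero_le)
  then show ?case by (simp add: cop_zero_form)
next
  case (Suc n)
  have "cop \<beta> (a * b) = 0" if a: "counit a = 0" and b: "b \<in> aug_power n" for a b
  proof -
    define \<beta>' where "\<beta>' = (\<lambda>u w. cop (\<lambda>c d. \<beta> (u * c) (w * d)) b)"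
    have zero: "\<beta>' u w = 0" if "u \<in> aug_power i" "w \<in> aug_power j" "i + j \<ge> 1" for u w i j
      unfolding \<beta>'_def
    proof (rule Suc.IH[OF b bilin_mult[OF Suc.prems(2)]])
      show "kills_order n (\<lambda>c d. \<beta> (u * c) (w * d))"
        unfolding kills_order_def
      proof (intro allI impI)
        fix i' j' c d assume "n \<le> i' + j'" "c \<in> aug_power i'" "d \<in> aug_power j'"
        then show "\<beta> (u * c) (w * d) = 0"
          using Suc.prems(3)[unfolded kills_order_def, rule_format, of "i + i'" "j + j'" "u * c" "w * d"]
            aug_power_mult that by simp
      qed
    qed
    have "cop \<beta> (a * b) = cop \<beta>' a"
      unfolding \<beta>'_def by (rule cop_mult[OF Suc.prems(2)])
    also have "\<dots> = \<beta>' 1 a + \<beta>' a 1 - counit a * \<beta>' 1 1"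
      using bilin_mult_cop[OF Suc.prems(2)] zero[of _ 1 _ 1] counit_zero_in_aug_power
      by (intro cop_eq_of_kills_augmentation) (auto simp: \<beta>'_def)
    also have "\<dots> = 0"
      using zero[of 1 0 a 1] zero[of a 1 1 0] a counit_zero_in_aug_power[OF a] by simp
    finally show ?thesis .
  qed
  then show ?case
    using functional_zero_on_span[OF functional_cop[OF Suc.prems(2)]
        Suc.prems(1)[unfolded aug_power.simps]] by blast
qed

text \<open>The associated graded coalgebra is cocommutative, because the associated graded algebra is generated
in degree one, where all elements are primitive. Modulo higher order,
\<open>\<Delta> (a b) = (a \<otimes> 1 + 1 \<otimes> a) \<Delta> b\<close> for \<open>a\<close> in \<open>I\<close>, which is symmetric if
\<open>\<Delta> b\<close> is.\<close>

lemma cop_aug_power_cocommutative: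
  "x \<in> aug_power n \<Longrightarrow> bilin \<beta> \<Longrightarrow> kills_order (Suc n) \<beta> \<Longrightarrow> cop \<beta> x = cop (\<lambda>u w. \<beta> w u) x"
proof (induction n arbitrary: x \<beta>)
  case 0
  have "\<beta> u w = 0" if "counit u = 0" "counit w = 0" for u w
    using 0(3)[unfolded kills_order_def, rule_format, of 1 1 u w] counit_zero_in_aug_power that by simp
  then show ?case
    using cop_eq_of_kills_augmentation[OF 0(2)] cop_eq_of_kills_augmentation[OF bilin_swap[OF 0(2)]]
    by (simp add: add.commute)
next
  case (Suc n)
  have "cop \<beta> (a * b) = cop (\<lambda>u w. \<beta> w u) (a * b)" if a: "counit a = 0" and b: "b \<in> aug_power n" for a b
  proof -
    have split: "cop \<gamma> (a * b) = cop (\<lambda>c d. \<gamma> c (a * d)) b + cop (\<lambda>c d. \<gamma> (a * c) d) b"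
      if \<gamma>: "bilin \<gamma>" "kills_order (Suc (Suc n)) \<gamma>" for \<gamma>
    proof -
      define \<gamma>' where "\<gamma>' = (\<lambda>u w. cop (\<lambda>c d. \<gamma> (u * c) (w * d)) b)"
      have zero: "\<gamma>' u w = 0" if "counit u = 0" "counit w = 0" for u w
        unfolding \<gamma>'_def
      proof (rule cop_aug_power_eq_0[OF b bilin_mult[OF \<gamma>(1)]])
        show "kills_order n (\<lambda>c d. \<gamma> (u * c) (w * d))"
          unfolding kills_order_def
        proof (intro allI impI)
          fix i j c d assume "n \<le> i + j" "c \<in> aug_power i" "d \<in> aug_power j"
          then show "\<gamma> (u * c) (w * d) = 0"
            using \<gamma>(2)[unfolded kills_order_def, rule_format, of "Suc i" "Suc j" "u * c" "w * d"]
              aug_power_Suc_mult that by simp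
        qed
      qed
      have "cop \<gamma> (a * b) = cop \<gamma>' a"
        unfolding \<gamma>'_def by (rule cop_mult[OF \<gamma>(1)])
      also have "\<dots> = \<gamma>' 1 a + \<gamma>' a 1 - counit a * \<gamma>' 1 1"
        using bilin_mult_cop[OF \<gamma>(1)] zero
        by (intro cop_eq_of_kills_augmentation) (auto simp: \<gamma>'_def)
      finally show ?thesis by (simp add: a \<gamma>'_def)
    qed
    have kills: "kills_order (Suc n) (\<lambda>c d. \<beta> c (a * d))" "kills_order (Suc n) (\<lambda>c d. \<beta> (a * c) d)"
      unfolding kills_order_def
    proof (safe)
      fix i j c d assume *: "Suc n \<le> i + j" "c \<in> aug_power i" "d \<in> aug_power j"
      then show "\<beta> c (a * d) = 0" "\<beta> (a * c) d = 0"
        using Suc.prems(3)[unfolded kills_order_def, rule_format, of "i" "Suc j" "c" "a * d"]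
           Suc.prems(3)[unfolded kills_order_def, rule_format, of "Suc i" "j" "a * c" "d"]
          aug_power_Suc_mult[OF a] by simp_all
    qed
    have "kills_order (Suc (Suc n)) (\<lambda>u w. \<beta> w u)"
      using Suc.prems(3) unfolding kills_order_def by (metis add.commute)
    then show ?thesis
      using split[OF Suc.prems(2,3)] split[OF bilin_swap[OF Suc.prems(2)]]
        Suc.IH[OF b _ kills(1)] Suc.IH[OF b _ kills(2)] bilin_mult[OF Suc.prems(2), of 1 a]
        bilin_mult[OF Suc.prems(2), of a 1]
      by simp
  qed
  then show ?case
    using functional_eq_on_span[OF functional_cop[OF Suc.prems(2)]
        functional_cop[OF bilin_swap[OF Suc.prems(2)]] Suc.prems(1)[unfolded aug_power.simps]] by blast
qed

end

section \<open>Homogeneous elements and graded bilinear forms\<close>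

definition form_scale :: "'k::field \<Rightarrow> ('a \<Rightarrow> 'a \<Rightarrow> 'k) \<Rightarrow> ('a \<Rightarrow> 'a \<Rightarrow> 'k)" where
  "form_scale c \<beta> = (\<lambda>x y. c * \<beta> x y)"

interpretation forms: vector_space form_scale
  by unfold_locales (auto simp: form_scale_def fun_eq_iff distrib_left distrib_right)

lemma linear_form_scale_iff:
  "Vector_Spaces.linear form_scale form_scale F \<longleftrightarrow>
     (\<forall>\<beta> \<gamma>. F (\<lambda>x y. \<beta> x y + \<gamma> x y) = (\<lambda>x y. F \<beta> x y + F \<gamma> x y)) \<and>
     (\<forall>c \<beta>. F (\<lambda>x y. c * \<beta> x y) = (\<lambda>x y. c * F \<beta> x y))"
  by (simp add: Vector_Spaces.linear_iff forms.vector_space_axioms form_scale_def plus_fun_def)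

context graded_connected_hopf_algebra
begin

lemma degree_zero_eq_scalar:
  assumes "x \<in> G 0"
  shows "x = smul (counit x) 1"
proof -
  obtain B where B: "B \<subseteq> G 0" "independent B" "G 0 \<subseteq> span B" "card B = 1"
    using basis_exists[of "G 0"] connected by metis
  then obtain b where b: "B = {b}" using card_1_singletonE by blast
  obtain c d where c: "1 = smul c b" and d: "x = smul d b"
    using B(3) graded_one assms unfolding b span_singleton by blast
  have "c \<noteq> 0" using c by auto
  then have "x = smul (d / c) 1" by (simp add: c d)
  moreover from this have "counit x = d / c"
    by (metis counit_scale counit_one mult.right_neutral)
  ultimately show ?thesis by simp
qed

definition component :: "'a \<Rightarrow> nat \<Rightarrow> 'a" where
  "component x = (THE f. (\<forall>m. f m \<in> G m) \<and> finite {m. f m \<noteq> 0} \<and> x = (\<Sum>m | f m \<noteq> 0. f m))"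

lemma component_props:
  "component x m \<in> G m" "finite {m. component x m \<noteq> 0}" "(\<Sum>m | component x m \<noteq> 0. component x m) = x"
  using theI'[OF direct_sum[of x]] unfolding component_def[symmetric] by auto

lemma component_eqI:
  assumes "finite A" "\<And>m. f m \<in> G m" "\<And>m. m \<notin> A \<Longrightarrow> f m = 0" "x = sum f A"
  shows "component x = f"
proof -
  have "{m. f m \<noteq> 0} \<subseteq> A" using assms(3) by blast
  then have "finite {m. f m \<noteq> 0}" "x = (\<Sum>m | f m \<noteq> 0. f m)"
    using assms(1,4) by (auto intro: finite_subset sum.mono_neutral_right)
  then show ?thesis
    unfolding component_def using assms(2) by (intro the1_equality[OF direct_sum]) auto
qed

lemma component_add: "component (x + y) m = component x m + component y m"
proof -
  let ?A = "{m. component x m \<noteq> 0} \<union> {m. component y m \<noteq> 0}"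
  have fin: "finite ?A" using component_props(2) by simp
  have "(\<Sum>m\<in>?A. component x m) = x" "(\<Sum>m\<in>?A. component y m) = y"
    using component_props(3)[of x] component_props(3)[of y] fin
    by (metis (mono_tags, lifting) Diff_iff Un_upper1 mem_Collect_eq sum.mono_neutral_left,
        metis (mono_tags, lifting) Diff_iff Un_upper2 mem_Collect_eq sum.mono_neutral_left)
  then have "component (x + y) = (\<lambda>m. component x m + component y m)"
    using fin component_props(1) component_subspace
    by (intro component_eqI[of ?A]) (auto simp: sum.distrib subspace_add)
  then show ?thesis by simp
qed

lemma component_scale: "component (smul c x) m = smul c (component x m)"
proof -
  have "component (smul c x) = (\<lambda>m. smul c (component x m))"
    using component_props component_subspace
    by (intro component_eqI[of "{m. component x m \<noteq> 0}"])
       (auto simp: scale_sum_right[symmetric] subspace_scale)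
  then show ?thesis by simp
qed

lemma component_homogeneous: "x \<in> G p \<Longrightarrow> component x m = (if m = p then x else 0)"
  using component_eqI[of "{p}" "\<lambda>m. if m = p then x else 0" x] component_subspace
  by (auto simp: subspace_0)

lemma in_span_components: "x \<in> span (\<Union>m. G m)"
proof -
  have "(\<Sum>m | component x m \<noteq> 0. component x m) \<in> span (\<Union>m. G m)"
    using component_props(1) by (intro span_sum span_base) blast
  then show ?thesis by (simp add: component_props(3))
qed

lemma counit_zero_in_span:
  assumes "counit x = 0"
  shows "x \<in> span (\<Union>m\<in>{1..}. G m)"
proof -
  have "counit (component x m) = (if m = 0 then counit (component x 0) else 0)" for m
    using graded_counit component_props(1) by auto
  then have "(\<Sum>m | component x m \<noteq> 0. counit (component x m)) =
      (\<Sum>m | component x m \<noteq> 0. if m = 0 then counit (component x 0) else 0)"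
    by (intro sum.cong refl)
  moreover have "(\<Sum>m | component x m \<noteq> 0. counit (component x m)) = counit x"
    by (simp add: functional_sum[OF functional_counit, symmetric] component_props(3))
  ultimately have "counit x = (\<Sum>m | component x m \<noteq> 0. if m = 0 then counit (component x 0) else 0)"
    by simp
  then have "counit (component x 0) = 0"
    using assms component_props(2) functional_0[OF functional_counit]
    by (auto simp: sum.delta split: if_splits)
  then have "component x 0 = 0"
    using degree_zero_eq_scalar[OF component_props(1)] by (metis scale_zero_left)
  then have "component x m \<in> span (\<Union>m\<in>{1..}. G m)" for m
  proof (cases "m = 0")
    case False
    then show ?thesis using component_props(1)[of x m] by (intro span_base) force
  qed (simp add: span_zero)
  then have "(\<Sum>m | component x m \<noteq> 0. component x m) \<in> span (\<Union>m\<in>{1..}. G m)"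
    by (intro span_sum)
  then show ?thesis by (simp add: component_props(3))
qed

lemma functional_eqI:
  assumes "functional f" "functional g" "\<And>p x. x \<in> G p \<Longrightarrow> f x = g x"
  shows "f = g"
  using functional_eq_on_span[OF assms(1,2) in_span_components] assms(3) by blast

lemma bilin_eqI:
  assumes "bilin \<beta>" "bilin \<gamma>" "\<And>p q x y. x \<in> G p \<Longrightarrow> y \<in> G q \<Longrightarrow> \<beta> x y = \<gamma> x y"
  shows "\<beta> = \<gamma>"
proof
  fix x
  have "(\<lambda>x. \<beta> x y) = (\<lambda>x. \<gamma> x y)" if "y \<in> G q" for y q
    using assms that by (intro functional_eqI) (auto simp: bilin_iff)
  then have "\<beta> x y = \<gamma> x y" if "y \<in> G q" for y q
    using that by meson
  then show "\<beta> x = \<gamma> x"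
    using assms by (intro functional_eqI) (auto simp: bilin_iff)
qed

text \<open>By connectedness \<open>I\<close> lives in positive degrees. So only finitely many powers of \<open>I\<close> are visible in
a given degree, which makes the filtration finite there.\<close>

lemma aug_power_in_span: "aug_power n \<subseteq> span (\<Union>m\<in>{n..}. G m)"
proof (induction n)
  case 0
  then show ?case using in_span_components by (simp add: atLeast_0 subsetI)
next
  case (Suc n)
  have "x * y \<in> span (\<Union>m\<in>{Suc n..}. G m)" if "counit x = 0" "y \<in> aug_power n" for x y
  proof (rule mult_in_span[OF counit_zero_in_span[OF that(1)] subsetD[OF Suc that(2)]])
    fix a b assume "a \<in> (\<Union>m\<in>{1..}. G m)" "b \<in> (\<Union>m\<in>{n..}. G m)"
    then obtain p q where "p \<ge> 1" "a \<in> G p" "q \<ge> n" "b \<in> G q" by blast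
    then have "a * b \<in> G (p + q)" "p + q \<ge> Suc n" using graded_mult by auto
    then show "a * b \<in> span (\<Union>m\<in>{Suc n..}. G m)" by (intro span_base) blast
  qed
  then show ?case
    unfolding aug_power.simps by (intro span_minimal subspace_span) blast
qed

lemma cop_homogeneous_eq_0:
  assumes "bilin \<beta>" "x \<in> G m"
    and "\<And>p u w. p \<le> m \<Longrightarrow> u \<in> G p \<Longrightarrow> w \<in> G (m - p) \<Longrightarrow> \<beta> u w = 0"
  shows "cop \<beta> x = 0"
proof -
  obtain t where t: "tensor2_eq smul (\<Delta> x) t" "Poly_Mapping.keys t \<subseteq> (\<Union>p\<le>m. G p \<times> G (m - p))"
    using graded_coproduct[OF assms(2)] by blast
  have "lin_ext (*) (\<lambda>(u, w). \<beta> u w) t = 0"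
    unfolding lin_ext_def using t(2) assms(3) by (intro sum.neutral) fastforce
  then show ?thesis using cop_tensor2_eq[OF assms(1) t(1)] by simp
qed

text \<open>Comparing \<open>S x_1 * x_2 = \<epsilon>(x) 1\<close> with \<open>S x = S x_1 * \<epsilon>(x_2)\<close> leaves only terms in which \<open>x_1\<close> has
degree less than \<open>m\<close>, because \<open>x_2 = \<epsilon>(x_2) 1\<close> in degree zero.\<close>

lemma antipode_homogeneous:
  assumes S: "is_antipode S"
  shows "x \<in> G m \<Longrightarrow> S x \<in> G m"
proof (induction m arbitrary: x rule: less_induct)
  case (less m)
  obtain t where t: "tensor2_eq smul (\<Delta> x) t" "Poly_Mapping.keys t \<subseteq> (\<Union>p\<le>m. G p \<times> G (m - p))"
    using graded_coproduct[OF less.prems] by blast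
  have Slin: "Vector_Spaces.linear smul smul S" using S by (simp add: is_antipode_def)
  have "lin_ext smul (\<lambda>(u, w). smul (counit w) u) (\<Delta> x) = lin_ext smul (\<lambda>(u, w). smul (counit w) u) t"
    by (rule tensor2_eq_imp_lin_ext_eq[OF t(1) vector_space_axioms])
      (auto simp: Vector_Spaces.linear_iff vector_space_axioms scale_right_distrib scale_left_distrib
        counit_add counit_scale mult.commute)
  then have x: "lin_ext smul (\<lambda>(u, w). smul (counit w) u) t = x" by (simp add: counit_right)
  have "lin_ext smul (\<lambda>(u, w). S u * w) (\<Delta> x) = lin_ext smul (\<lambda>(u, w). S u * w) t"
    by (rule tensor2_eq_imp_lin_ext_eq[OF t(1) vector_space_axioms])
      (auto simp: Vector_Spaces.linear_iff vector_space_axioms antipode_add[OF S] antipode_scale[OF S]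
        distrib_left distrib_right mult_scale_left mult_scale_right)
  then have conv: "lin_ext smul (\<lambda>(u, w). S u * w) t = smul (counit x) 1"
    using S by (simp add: is_antipode_def)
  have "S x = lin_ext smul (\<lambda>i. S (case i of (u, w) \<Rightarrow> smul (counit w) u)) t"
    using lin_ext_linear_image[OF Slin, of "\<lambda>(u, w). smul (counit w) u" t] x by simp
  also have "\<dots> = lin_ext smul (\<lambda>(u, w). smul (counit w) (S u)) t"
    by (simp add: case_prod_unfold antipode_scale[OF S])
  finally have "smul (counit x) 1 - S x = lin_ext smul (\<lambda>(u, w). S u * w) t - lin_ext smul (\<lambda>(u, w). smul (counit w) (S u)) t"
    by (simp add: conv)
  also have "\<dots> = (\<Sum>(u, w)\<in>Poly_Mapping.keys t. smul (Poly_Mapping.lookup t (u, w)) (S u * w - smul (counit w) (S u)))"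
    by (simp add: lin_ext_def case_prod_unfold sum_subtractf scale_right_diff_distrib)
  also have "\<dots> \<in> G m"
  proof (rule subspace_sum[OF component_subspace], safe)
    fix u w assume "(u, w) \<in> Poly_Mapping.keys t"
    then obtain p where p: "p \<le> m" "u \<in> G p" "w \<in> G (m - p)" using t(2) by blast
    have "S u * w - smul (counit w) (S u) \<in> G m"
    proof (cases "p = m")
      case True
      then have "w = smul (counit w) 1" using p degree_zero_eq_scalar by simp
      then have "S u * w = smul (counit w) (S u)" by (metis mult_scale_right mult.right_neutral)
      then show ?thesis using component_subspace subspace_0 by simp
    next
      case False
      then have "S u \<in> G p" using less.IH p by simp
      then have "S u * w \<in> G (p + (m - p))" using graded_mult p by blast
      moreover have "counit w = 0" using False p graded_counit[of "m - p" w] by simp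
      ultimately show ?thesis using p by simp
    qed
    then show "smul (Poly_Mapping.lookup t (u, w)) (S u * w - smul (counit w) (S u)) \<in> G m"
      by (rule subspace_scale[OF component_subspace])
  qed
  finally have "smul (counit x) 1 - S x \<in> G m" .
  moreover have "smul (counit x) 1 \<in> G m"
    using graded_counit[OF _ less.prems] graded_one component_subspace
    by (cases "m = 0") (auto intro: subspace_scale subspace_0)
  ultimately show ?case
    using subspace_diff[OF component_subspace, of "smul (counit x) 1" m "smul (counit x) 1 - S x"] by simp
qed

text \<open>The dual space of the degree \<open>m\<close> part of \<open>H \<otimes> H\<close>.\<close>

definition graded_forms :: "nat \<Rightarrow> ('a \<Rightarrow> 'a \<Rightarrow> 'k) set" where
  "graded_forms m = {\<beta>. bilin \<beta> \<and> (\<forall>p q x y. x \<in> G p \<longrightarrow> y \<in> G q \<longrightarrow> p + q \<noteq> m \<longrightarrow> \<beta> x y = 0)}"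

lemma graded_formsD:
  "\<beta> \<in> graded_forms m \<Longrightarrow> bilin \<beta>"
  "\<beta> \<in> graded_forms m \<Longrightarrow> x \<in> G p \<Longrightarrow> y \<in> G q \<Longrightarrow> p + q \<noteq> m \<Longrightarrow> \<beta> x y = 0"
  by (auto simp: graded_forms_def)

lemma subspace_graded_forms: "forms.subspace (graded_forms m)"
proof (rule forms.subspaceI)
  show "0 \<in> graded_forms m" by (simp add: graded_forms_def bilin_def)
next
  fix \<beta> \<gamma> assume "\<beta> \<in> graded_forms m" "\<gamma> \<in> graded_forms m"
  then show "\<beta> + \<gamma> \<in> graded_forms m"
    unfolding graded_forms_def mem_Collect_eq bilin_iff functional_def plus_fun_apply
    by (simp add: distrib_left add.assoc add.left_commute)
next
  fix c \<beta> assume "\<beta> \<in> graded_forms m"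
  then show "form_scale c \<beta> \<in> graded_forms m"
    unfolding graded_forms_def mem_Collect_eq bilin_iff functional_def form_scale_def
    by (simp add: distrib_left mult.left_commute)
qed

lemma graded_form_eq_0_span:
  assumes "\<beta> \<in> graded_forms m" "x \<in> span (\<Union>p\<in>{i..}. G p)" "y \<in> span (\<Union>q\<in>{j..}. G q)" "i + j > m"
  shows "\<beta> x y = 0"
proof -
  have fnl: "functional (\<lambda>x. \<beta> x y)" "functional (\<beta> x)" for x y
    using graded_formsD(1)[OF assms(1)] by (auto simp: bilin_iff)
  have "\<beta> u y = 0" if "u \<in> G p" "p \<ge> i" for u p
    using assms(4) that by (intro functional_zero_on_span[OF fnl(2) assms(3)])
      (auto intro!: graded_formsD(2)[OF assms(1) that(1)])
  then show ?thesis
    by (intro functional_zero_on_span[OF fnl(1) assms(2)]) auto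
qed

lemma graded_form_kills_order: "\<beta> \<in> graded_forms m \<Longrightarrow> kills_order (Suc m) \<beta>"
  unfolding kills_order_def
  using graded_form_eq_0_span[OF _ subsetD[OF aug_power_in_span] subsetD[OF aug_power_in_span]]
  by (simp add: Suc_le_eq)

end

section \<open>The trace identity for the antipode\<close>

text \<open>The setting of the trace identity: an antipode and finite-dimensional homogeneous components.\<close>

locale hopf_finite_type = graded_connected_hopf_algebra smul \<Delta> counit G
  for smul :: "'k::field \<Rightarrow> 'a::ring_1 \<Rightarrow> 'a"
    and \<Delta> :: "'a \<Rightarrow> ('a \<times> 'a \<Rightarrow>\<^sub>0 'k)"
    and counit :: "'a \<Rightarrow> 'k"
    and G :: "nat \<Rightarrow> 'a set" +
  fixes S :: "'a \<Rightarrow> 'a"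
  assumes antipode: "is_antipode S"
    and finite_type: "\<And>m. \<exists>B. finite B \<and> span B = G m"
begin

text \<open>The same choice of basis as in \<^const>\<open>trace_on\<close>, so that traces on \<open>G m\<close> unfold to sums over it.\<close>

definition hbasis :: "nat \<Rightarrow> 'a set" where
  "hbasis m = (SOME B. independent B \<and> span B = G m)"

definition coord :: "nat \<Rightarrow> 'a \<Rightarrow> 'a \<Rightarrow> 'k" where
  "coord m b x = representation (hbasis m) (component x m) b"

lemma hbasis: "independent (hbasis m)" "span (hbasis m) = G m" "finite (hbasis m)"
proof -
  obtain A where A: "finite A" "span A = G m" using finite_type by blast
  then have "\<exists>B. independent B \<and> span B = G m" by (metis finite_span_obtains_basis)
  then show *: "independent (hbasis m)" "span (hbasis m) = G m"
    unfolding hbasis_def by (metis (mono_tags, lifting) someI_ex)+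
  show "finite (hbasis m)"
    using independent_span_bound[OF A(1) *(1)] A(2) *(2) span_superset by blast
qed

lemma hbasis_in: "b \<in> hbasis m \<Longrightarrow> b \<in> G m"
  using hbasis(2) span_base by blast

lemma dim_eq_card_hbasis: "dim (G m) = card (hbasis m)"
  by (rule dim_eq_card[OF _ hbasis(1)]) (metis hbasis(2) span_span)

lemma functional_coord: "functional (coord m b)"
  unfolding functional_def coord_def component_add component_scale
  using hbasis[of m] component_props(1)
  by (simp add: representation_add representation_scale)

lemma coord_homogeneous: "x \<in> G p \<Longrightarrow> coord m b x = (if m = p then representation (hbasis m) x b else 0)"
  by (simp add: coord_def component_homogeneous representation_zero)

lemma coord_hbasis: "x \<in> hbasis m \<Longrightarrow> coord m b x = (if x = b then 1 else 0)"
  using hbasis_in[of x m] representation_basis[OF hbasis(1), of x m] by (simp add: coord_homogeneous)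

lemma expand_hbasis: "x \<in> G p \<Longrightarrow> (\<Sum>b\<in>hbasis p. smul (coord p b x) b) = x"
  using sum_representation_eq[OF hbasis(1), of x p "hbasis p"] hbasis(2,3)
  by (simp add: coord_homogeneous)

definition form_index :: "nat \<Rightarrow> (nat \<times> 'a \<times> 'a) set" where
  "form_index m = (SIGMA p:{..m}. hbasis p \<times> hbasis (m - p))"

definition dual_form :: "nat \<Rightarrow> nat \<times> 'a \<times> 'a \<Rightarrow> 'a \<Rightarrow> 'a \<Rightarrow> 'k" where
  "dual_form m = (\<lambda>(p, b, c) x y. coord p b x * coord (m - p) c y)"

lemma finite_form_index: "finite (form_index m)"
  unfolding form_index_def using hbasis(3) by (intro finite_SigmaI finite_cartesian_product) auto

lemma sum_form_index:
  "(\<Sum>j\<in>form_index m. f j) = (\<Sum>p\<le>m. \<Sum>b\<in>hbasis p. \<Sum>c\<in>hbasis (m - p). f (p, b, c))"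
proof -
  have "(\<Sum>j\<in>form_index m. f j) = (\<Sum>p\<le>m. \<Sum>z\<in>hbasis p \<times> hbasis (m - p). f (p, z))"
    unfolding form_index_def
    using hbasis(3) sum.Sigma[of "{..m}" "\<lambda>p. hbasis p \<times> hbasis (m - p)" "\<lambda>p z. f (p, z)"]
    by simp
  then show ?thesis by (simp add: sum.cartesian_product case_prod_unfold)
qed

lemma dual_form_in: "j \<in> form_index m \<Longrightarrow> dual_form m j \<in> graded_forms m"
proof -
  have fc: "coord p b (x + y) = coord p b x + coord p b y" "coord p b (smul c x) = c * coord p b x" for p b x y c
    using functional_coord by (auto simp: functional_def)
  assume "j \<in> form_index m"
  then obtain p b c where j: "j = (p, b, c)" "p \<le> m" by (auto simp: form_index_def)
  have "bilin (dual_form m j)"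
    by (simp add: bilin_def dual_form_def j(1) fc distrib_left distrib_right)
  then show ?thesis
    by (auto simp: graded_forms_def dual_form_def j coord_homogeneous)
qed

text \<open>The products of coordinate functionals of total degree \<open>m\<close> span the graded forms, and the
coefficients are the values on pairs of basis vectors.\<close>

lemma form_expansion:
  assumes "\<beta> \<in> graded_forms m"
  shows "\<beta> = (\<Sum>(p, b, c)\<in>form_index m. form_scale (\<beta> b c) (dual_form m (p, b, c)))"
proof (rule bilin_eqI)
  note \<beta> = graded_formsD[OF assms]
  have \<gamma>: "(\<Sum>(p, b, c)\<in>form_index m. form_scale (\<beta> b c) (dual_form m (p, b, c))) \<in> graded_forms m"
    using dual_form_in
    by (intro forms.subspace_sum subspace_graded_forms)
      (auto intro!: forms.subspace_scale[OF subspace_graded_forms])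
  show "bilin \<beta>" by (rule \<beta>(1))
  show "bilin (\<Sum>(p, b, c)\<in>form_index m. form_scale (\<beta> b c) (dual_form m (p, b, c)))"
    using \<gamma> graded_formsD(1) by blast
  fix p q x y assume x: "x \<in> G p" and y: "y \<in> G q"
  show "\<beta> x y = (\<Sum>(p, b, c)\<in>form_index m. form_scale (\<beta> b c) (dual_form m (p, b, c))) x y"
  proof (cases "p + q = m")
    case False
    then show ?thesis using \<beta>(2)[OF x y] graded_formsD(2)[OF \<gamma> x y] by simp
  next
    case True
    have fnl: "functional (\<lambda>x. \<beta> x y)" "functional (\<beta> x)" for x y
      using \<beta>(1) by (auto simp: bilin_iff)
    have sumfun: "(\<Sum>j\<in>J. F j) x y = (\<Sum>j\<in>J. F j x y)" for J :: "'z set" and F :: "'z \<Rightarrow> 'a \<Rightarrow> 'a \<Rightarrow> 'k"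
      by (induction J rule: infinite_finite_induct) (auto simp: plus_fun_def zero_fun_def)
    have "(\<Sum>(p, b, c)\<in>form_index m. form_scale (\<beta> b c) (dual_form m (p, b, c))) x y =
       (\<Sum>r\<le>m. \<Sum>b\<in>hbasis r. \<Sum>c\<in>hbasis (m - r). \<beta> b c * (coord r b x * coord (m - r) c y))"
      by (simp add: sumfun case_prod_unfold sum_form_index form_scale_def dual_form_def)
    also have "\<dots> = (\<Sum>r\<le>m. if r = p then \<Sum>b\<in>hbasis r. \<Sum>c\<in>hbasis (m - r). \<beta> b c * (coord r b x * coord (m - r) c y) else 0)"
      by (intro sum.cong refl) (simp add: coord_homogeneous[OF x])
    also have "\<dots> = (\<Sum>b\<in>hbasis p. \<Sum>c\<in>hbasis q. \<beta> b c * (coord p b x * coord q c y))"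
      using True by (simp add: sum.delta) auto
    also have "\<dots> = (\<Sum>b\<in>hbasis p. coord p b x * (\<Sum>c\<in>hbasis q. coord q c y * \<beta> b c))"
      by (simp add: sum_distrib_left mult_ac)
    also have "\<dots> = (\<Sum>b\<in>hbasis p. coord p b x * \<beta> b y)"
    proof -
      have "(\<Sum>c\<in>hbasis q. coord q c y * \<beta> b c) = \<beta> b (\<Sum>c\<in>hbasis q. smul (coord q c y) c)" for b
        using fnl(2)[of b] by (simp add: functional_sum functional_def)
      then show ?thesis by (simp add: expand_hbasis[OF y])
    qed
    also have "\<dots> = \<beta> (\<Sum>b\<in>hbasis p. smul (coord p b x) b) y"
      unfolding functional_sum[OF fnl(1)] using fnl(1)[of y] by (simp add: functional_def)
    also have "\<dots> = \<beta> x y" by (simp add: expand_hbasis[OF x])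
    finally show ?thesis by simp
  qed
qed

lemma finite_span_graded_forms: "\<exists>A. finite A \<and> forms.span A = graded_forms m"
proof -
  have "forms.span (dual_form m ` form_index m) = graded_forms m"
    using form_expansion
    by (intro forms.span_frame[OF finite_form_index dual_form_in subspace_graded_forms,
          where l = "\<lambda>(p, b, c) \<beta>. \<beta> b c"]) (auto simp: case_prod_unfold)
  then show ?thesis using finite_form_index by blast
qed

lemma trace_on_graded_forms:
  assumes "Vector_Spaces.linear form_scale form_scale F" "\<And>\<beta>. \<beta> \<in> graded_forms m \<Longrightarrow> F \<beta> \<in> graded_forms m"
  shows "trace_on form_scale (graded_forms m) F =
    (\<Sum>p\<le>m. \<Sum>b\<in>hbasis p. \<Sum>c\<in>hbasis (m - p). F (dual_form m (p, b, c)) b c)"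
proof -
  have "trace_on form_scale (graded_forms m) F = (\<Sum>j\<in>form_index m. (\<lambda>(p, b, c) \<beta>. \<beta> b c) j (F (dual_form m j)))"
  proof (rule forms.trace_on_eq_sum_frame[OF finite_form_index dual_form_in _ _ subspace_graded_forms assms])
    show "Vector_Spaces.linear form_scale (*) ((\<lambda>(p, b, c) \<beta>. \<beta> b c) j)" for j :: "nat \<times> 'a \<times> 'a"
      by (simp add: case_prod_unfold Vector_Spaces.linear_iff forms.vector_space_axioms
          vector_space_over_itself.vector_space_axioms form_scale_def)
    show "\<beta> = (\<Sum>j\<in>form_index m. form_scale ((\<lambda>(p, b, c) \<beta>. \<beta> b c) j \<beta>) (dual_form m j))"
      if "\<beta> \<in> graded_forms m" for \<beta>
      using form_expansion[OF that] by (simp add: case_prod_unfold)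
  qed
  then show ?thesis by (simp add: sum_form_index)
qed

text \<open>The transposes of \<open>x \<otimes> y \<mapsto> x_1 \<otimes> x_2 y\<close>, its inverse, the exchange of factors, \<open>id \<otimes> S\<close>,
\<open>T (x \<otimes> y) = x y_1 \<otimes> S y_2\<close>, and of the defect \<open>x_1 y \<otimes> x_2 - x_2 y \<otimes> x_1\<close>. Transposition
reverses the order of composition.\<close>

definition galois :: "('a \<Rightarrow> 'a \<Rightarrow> 'k) \<Rightarrow> ('a \<Rightarrow> 'a \<Rightarrow> 'k)" where
  "galois \<beta> x y = cop (\<lambda>u w. \<beta> u (w * y)) x"

definition galois_inv :: "('a \<Rightarrow> 'a \<Rightarrow> 'k) \<Rightarrow> ('a \<Rightarrow> 'a \<Rightarrow> 'k)" where
  "galois_inv \<beta> x y = cop (\<lambda>u w. \<beta> u (S w * y)) x"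

definition swap :: "('a \<Rightarrow> 'a \<Rightarrow> 'k) \<Rightarrow> ('a \<Rightarrow> 'a \<Rightarrow> 'k)" where
  "swap \<beta> x y = \<beta> y x"

definition antipode_snd :: "('a \<Rightarrow> 'a \<Rightarrow> 'k) \<Rightarrow> ('a \<Rightarrow> 'a \<Rightarrow> 'k)" where
  "antipode_snd \<beta> x y = \<beta> x (S y)"

definition sheared_antipode :: "('a \<Rightarrow> 'a \<Rightarrow> 'k) \<Rightarrow> ('a \<Rightarrow> 'a \<Rightarrow> 'k)" where
  "sheared_antipode \<beta> x y = cop (\<lambda>u w. \<beta> (x * u) (S w)) y"

definition cocomm_defect :: "('a \<Rightarrow> 'a \<Rightarrow> 'k) \<Rightarrow> ('a \<Rightarrow> 'a \<Rightarrow> 'k)" where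
  "cocomm_defect \<beta> x y = cop (\<lambda>u w. \<beta> (u * y) w - \<beta> (w * y) u) x"

lemmas S_linear = antipode_add[OF antipode] antipode_scale[OF antipode]

lemma linear_operators:
  "Vector_Spaces.linear form_scale form_scale galois"
  "Vector_Spaces.linear form_scale form_scale galois_inv"
  "Vector_Spaces.linear form_scale form_scale swap"
  "Vector_Spaces.linear form_scale form_scale antipode_snd"
  "Vector_Spaces.linear form_scale form_scale sheared_antipode"
  "Vector_Spaces.linear form_scale form_scale cocomm_defect"
  by (simp_all add: linear_form_scale_iff fun_eq_iff galois_def galois_inv_def swap_def
      antipode_snd_def sheared_antipode_def cocomm_defect_def cop_add_form cop_scale_form cop_diff_form
      right_diff_distrib)

lemma bilin_rules:
  assumes "bilin \<beta>"
  shows "\<beta> (x + y) z = \<beta> x z + \<beta> y z" "\<beta> z (x + y) = \<beta> z x + \<beta> z y"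
    "\<beta> (smul c x) z = c * \<beta> x z" "\<beta> z (smul c x) = c * \<beta> z x"
  using assms by (auto simp: bilin_def)

lemma bilin_mult_snd:
  assumes "bilin \<beta>"
  shows "bilin (\<lambda>u w. \<beta> u (w * y))"
  unfolding bilin_def by (simp add: bilin_rules[OF assms] distrib_right mult_scale_left)

lemma bilin_mult_fst:
  assumes "bilin \<beta>"
  shows "bilin (\<lambda>u w. \<beta> (u * y) w)"
  unfolding bilin_def by (simp add: bilin_rules[OF assms] distrib_right mult_scale_left)

lemma bilin_mult_antipode:
  assumes "bilin \<beta>"
  shows "bilin (\<lambda>u w. \<beta> (x * u) (S w))"
  unfolding bilin_def by (simp add: bilin_rules[OF assms] distrib_left mult_scale_right S_linear)

lemma bilin_galois:
  assumes "bilin \<beta>"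
  shows "bilin (galois \<beta>)"
  unfolding galois_def bilin_def
  by (simp add: bilin_rules[OF assms] cop_add[OF bilin_mult_snd[OF assms]]
      cop_scale[OF bilin_mult_snd[OF assms]] distrib_left mult_scale_right cop_add_form cop_scale_form)

lemma bilin_sheared_antipode:
  assumes "bilin \<beta>"
  shows "bilin (sheared_antipode \<beta>)"
  unfolding sheared_antipode_def bilin_def
  by (simp add: bilin_rules[OF assms] cop_add[OF bilin_mult_antipode[OF assms]]
      cop_scale[OF bilin_mult_antipode[OF assms]] distrib_right mult_scale_left cop_add_form cop_scale_form)

text \<open>In Sweedler notation, \<open>x_1 \<otimes> x_2 S(x_3) y = x_1 \<otimes> \<epsilon>(x_2) y = x \<otimes> y\<close>.\<close>

lemma galois_inv_galois:
  assumes "bilin \<beta>"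
  shows "galois_inv (galois \<beta>) = \<beta>"
proof (intro ext)
  fix x y
  note rules = bilin_rules[OF assms] distrib_left distrib_right mult_scale_left mult_scale_right S_linear
  have "galois_inv (galois \<beta>) x y = cop (\<lambda>u w. cop (\<lambda>a b. \<beta> a (b * (S w * y))) u) x"
    by (simp add: galois_inv_def galois_def)
  also have "\<dots> = cop (\<lambda>u w. cop (\<lambda>b c. \<beta> u (b * (S c * y))) w) x"
    by (rule cop_coassoc) (simp_all add: functional_def rules)
  also have "\<dots> = cop (\<lambda>u w. cop (\<lambda>b c. (\<lambda>z. \<beta> u (z * y)) (b * S c)) w) x"
    by (simp add: mult.assoc)
  also have "\<dots> = cop (\<lambda>u w. counit w * \<beta> u y) x"
    by (subst cop_antipode_right[OF antipode]) (simp_all add: functional_def rules)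
  also have "\<dots> = \<beta> x y"
    using assms by (intro cop_counit_right) (simp add: bilin_iff)
  finally show "galois_inv (galois \<beta>) x y = \<beta> x y" .
qed

text \<open>In Sweedler notation, \<open>x_1 y_1 \<otimes> x_2 y_2 S(y_3) = x_1 y \<otimes> x_2\<close>; the exchange of factors after
\<open>x \<otimes> y \<mapsto> x_1 \<otimes> x_2 y\<close> gives \<open>x_2 y \<otimes> x_1\<close> instead.\<close>

lemma sheared_antipode_galois:
  assumes "bilin \<beta>"
  shows "sheared_antipode (galois \<beta>) = (\<lambda>x y. galois (swap \<beta>) x y + cocomm_defect \<beta> x y)"
proof (intro ext)
  fix x y
  note rules = bilin_rules[OF assms] distrib_left distrib_right mult_scale_left mult_scale_right S_linear
  have bil: "bilin (\<lambda>u w. \<beta> u (w * z))" for z by (rule bilin_mult_snd[OF assms])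
  have "sheared_antipode (galois \<beta>) x y = cop (\<lambda>u w. cop (\<lambda>u' w'. \<beta> u' (w' * S w)) (x * u)) y"
    by (simp add: sheared_antipode_def galois_def)
  also have "\<dots> = cop (\<lambda>u w. cop (\<lambda>x1 x2. cop (\<lambda>a b. \<beta> (x1 * a) (x2 * b * S w)) u) x) y"
    by (simp add: cop_mult[OF bil])
  also have "\<dots> = cop (\<lambda>x1 x2. cop (\<lambda>u w. cop (\<lambda>a b. \<beta> (x1 * a) (x2 * b * S w)) u) y) x"
    by (rule cop_swap)
  also have "\<dots> = cop (\<lambda>x1 x2. cop (\<lambda>u w. cop (\<lambda>b c. \<beta> (x1 * u) (x2 * b * S c)) w) y) x"
    by (subst cop_coassoc) (simp_all add: functional_def rules)
  also have "\<dots> = cop (\<lambda>x1 x2. cop (\<lambda>u w. cop (\<lambda>b c. (\<lambda>z. \<beta> (x1 * u) (x2 * z)) (b * S c)) w) y) x"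
    by (simp add: mult.assoc)
  also have "\<dots> = cop (\<lambda>x1 x2. cop (\<lambda>u w. counit w * \<beta> (x1 * u) x2) y) x"
    by (subst cop_antipode_right[OF antipode]) (simp_all add: functional_def rules)
  also have "\<dots> = cop (\<lambda>x1 x2. \<beta> (x1 * y) x2) x"
    by (subst cop_counit_right) (simp_all add: functional_def rules)
  also have "\<dots> = galois (swap \<beta>) x y + cocomm_defect \<beta> x y"
    by (simp add: galois_def swap_def cocomm_defect_def cop_diff_form)
  finally show "sheared_antipode (galois \<beta>) x y = galois (swap \<beta>) x y + cocomm_defect \<beta> x y" .
qed

lemma galois_graded: "\<beta> \<in> graded_forms m \<Longrightarrow> galois \<beta> \<in> graded_forms m"
proof -
  assume \<beta>: "\<beta> \<in> graded_forms m"
  have "galois \<beta> x y = 0" if "x \<in> G p" "y \<in> G q" "p + q \<noteq> m" for p q x y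
    unfolding galois_def
  proof (rule cop_homogeneous_eq_0[OF bilin_mult_snd[OF graded_formsD(1)[OF \<beta>]] that(1)])
    fix r u w assume *: "r \<le> p" "u \<in> G r" "w \<in> G (p - r)"
    have "w * y \<in> G (p - r + q)" by (rule graded_mult[OF *(3) that(2)])
    then show "\<beta> u (w * y) = 0"
      using graded_formsD(2)[OF \<beta> *(2)] *(1) that(3) by simp
  qed
  then show ?thesis
    using bilin_galois[OF graded_formsD(1)[OF \<beta>]] by (auto simp: graded_forms_def)
qed

lemma sheared_antipode_graded: "\<beta> \<in> graded_forms m \<Longrightarrow> sheared_antipode \<beta> \<in> graded_forms m"
proof -
  assume \<beta>: "\<beta> \<in> graded_forms m"
  have "sheared_antipode \<beta> x y = 0" if "x \<in> G p" "y \<in> G q" "p + q \<noteq> m" for p q x y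
    unfolding sheared_antipode_def
  proof (rule cop_homogeneous_eq_0[OF bilin_mult_antipode[OF graded_formsD(1)[OF \<beta>]] that(2)])
    fix r u w assume *: "r \<le> q" "u \<in> G r" "w \<in> G (q - r)"
    have "S w \<in> G (q - r)" using antipode_homogeneous[OF antipode *(3)] .
    then show "\<beta> (x * u) (S w) = 0"
      using graded_formsD(2)[OF \<beta>, of "x * u" "p + r" "S w" "q - r"] graded_mult that * by simp
  qed
  then show ?thesis
    using bilin_sheared_antipode[OF graded_formsD(1)[OF \<beta>]] by (auto simp: graded_forms_def)
qed

lemma swap_graded: "\<beta> \<in> graded_forms m \<Longrightarrow> swap \<beta> \<in> graded_forms m"
  by (auto simp: graded_forms_def swap_def[abs_def] bilin_swap)

lemma antipode_snd_graded:
  assumes "\<beta> \<in> graded_forms m"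
  shows "antipode_snd \<beta> \<in> graded_forms m"
proof -
  have "bilin (antipode_snd \<beta>)"
    unfolding antipode_snd_def bilin_def
    by (simp add: bilin_rules[OF graded_formsD(1)[OF assms]] S_linear)
  moreover have "antipode_snd \<beta> x y = 0" if "x \<in> G p" "y \<in> G q" "p + q \<noteq> m" for p q x y
    unfolding antipode_snd_def
    by (rule graded_formsD(2)[OF assms that(1) antipode_homogeneous[OF antipode that(2)] that(3)])
  ultimately show ?thesis by (auto simp: graded_forms_def)
qed

lemma cocomm_defect_graded:
  assumes "\<beta> \<in> graded_forms m"
  shows "cocomm_defect \<beta> \<in> graded_forms m"
proof -
  have "cocomm_defect \<beta> = sheared_antipode (galois \<beta>) - galois (swap \<beta>)"
    by (simp add: sheared_antipode_galois[OF graded_formsD(1)[OF assms]] fun_eq_iff)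
  then show ?thesis
    using forms.subspace_diff[OF subspace_graded_forms] assms galois_graded swap_graded
      sheared_antipode_graded by simp
qed

text \<open>Dual to the decreasing filtration of \<open>H \<otimes> H\<close>, this is an increasing filtration of the graded
forms; it starts at zero and is exhausted at step \<open>m + 1\<close>.\<close>

definition filtered_forms :: "nat \<Rightarrow> nat \<Rightarrow> ('a \<Rightarrow> 'a \<Rightarrow> 'k) set" where
  "filtered_forms m n = {\<beta> \<in> graded_forms m. kills_order n \<beta>}"

lemma subspace_filtered_forms: "forms.subspace (filtered_forms m n)"
  using subspace_graded_forms[of m]
  by (auto simp: forms.subspace_def filtered_forms_def kills_order_def form_scale_def)

lemma filtered_forms_mono: "filtered_forms m n \<subseteq> filtered_forms m (Suc n)"
  unfolding filtered_forms_def kills_order_def using Suc_leD by blast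

lemma filtered_forms_0: "filtered_forms m 0 = {0}"
proof
  show "{0} \<subseteq> filtered_forms m 0"
    using forms.subspace_0[OF subspace_filtered_forms] by simp
  show "filtered_forms m 0 \<subseteq> {0}"
    by (auto simp: filtered_forms_def kills_order_def fun_eq_iff)
       (metis UNIV_I aug_power.simps(1))
qed

lemma filtered_forms_top: "filtered_forms m (Suc m) = graded_forms m"
  using graded_form_kills_order by (auto simp: filtered_forms_def)

lemma galois_filtered:
  assumes "\<beta> \<in> filtered_forms m n"
  shows "galois \<beta> \<in> filtered_forms m n"
proof -
  have \<beta>: "\<beta> \<in> graded_forms m" "kills_order n \<beta>" using assms by (auto simp: filtered_forms_def)
  have "galois \<beta> x y = 0" if "n \<le> i + j" "x \<in> aug_power i" "y \<in> aug_power j" for i j x y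
    unfolding galois_def
  proof (rule cop_aug_power_eq_0[OF that(2) bilin_mult_snd[OF graded_formsD(1)[OF \<beta>(1)]]])
    show "kills_order i (\<lambda>u w. \<beta> u (w * y))"
      unfolding kills_order_def
    proof (intro allI impI)
      fix a b u w assume *: "i \<le> a + b" "u \<in> aug_power a" "w \<in> aug_power b"
      have "w * y \<in> aug_power (b + j)" by (rule aug_power_mult[OF *(3) that(3)])
      then show "\<beta> u (w * y) = 0"
        using \<beta>(2)[unfolded kills_order_def, rule_format, of a "b + j" u "w * y"] * that(1) by simp
    qed
  qed
  then show ?thesis
    using galois_graded[OF \<beta>(1)] by (auto simp: filtered_forms_def kills_order_def)
qed

text \<open>Cocommutativity to leading order makes the defect lower the order of a form.\<close>

lemma cocomm_defect_filtered:
  assumes "\<beta> \<in> filtered_forms m (Suc n)"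
  shows "cocomm_defect \<beta> \<in> filtered_forms m n"
proof -
  have \<beta>: "\<beta> \<in> graded_forms m" "kills_order (Suc n) \<beta>" using assms by (auto simp: filtered_forms_def)
  have "cocomm_defect \<beta> x y = 0" if "n \<le> i + j" "x \<in> aug_power i" "y \<in> aug_power j" for i j x y
  proof -
    have "cop (\<lambda>u w. \<beta> (u * y) w) x = cop (\<lambda>u w. \<beta> (w * y) u) x"
    proof (rule cop_aug_power_cocommutative[OF that(2) bilin_mult_fst[OF graded_formsD(1)[OF \<beta>(1)]]])
      show "kills_order (Suc i) (\<lambda>u w. \<beta> (u * y) w)"
        unfolding kills_order_def
      proof (intro allI impI)
        fix a b u w assume *: "Suc i \<le> a + b" "u \<in> aug_power a" "w \<in> aug_power b"
        have "u * y \<in> aug_power (a + j)" by (rule aug_power_mult[OF *(2) that(3)])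
        then show "\<beta> (u * y) w = 0"
          using \<beta>(2)[unfolded kills_order_def, rule_format, of "a + j" b "u * y" w] * that(1) by simp
      qed
    qed
    then show ?thesis by (simp add: cocomm_defect_def cop_diff_form)
  qed
  then show ?thesis
    using cocomm_defect_graded[OF \<beta>(1)] by (auto simp: filtered_forms_def kills_order_def)
qed

text \<open>An injective endomorphism of a finite-dimensional space is surjective, so the one-sided inverse is
two-sided and maps each step of the filtration to itself.\<close>

lemma galois_inv_filtered:
  assumes "\<beta> \<in> filtered_forms m n"
  shows "galois_inv \<beta> \<in> filtered_forms m n" "galois (galois_inv \<beta>) = \<beta>"
proof -
  obtain A where A: "finite A" "forms.span A = graded_forms m" using finite_span_graded_forms by blast
  obtain B where B: "finite B" "forms.span B = filtered_forms m n"
    using forms.finite_span_subspace[OF A(1) subspace_filtered_forms, of m n] A(2)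
    by (auto simp: filtered_forms_def)
  have inv: "galois_inv (galois \<gamma>) = \<gamma>" if "\<gamma> \<in> filtered_forms m n" for \<gamma>
    using galois_inv_galois graded_formsD(1) that by (auto simp: filtered_forms_def)
  then have "galois ` filtered_forms m n = filtered_forms m n"
    by (intro forms.linear_inj_on_finite_span_imp_surj[OF B linear_operators(1) galois_filtered])
       (auto intro: inj_on_inverseI)
  then obtain \<gamma> where \<gamma>: "\<gamma> \<in> filtered_forms m n" "\<beta> = galois \<gamma>" using assms by blast
  then show "galois_inv \<beta> \<in> filtered_forms m n" "galois (galois_inv \<beta>) = \<beta>"
    using inv by simp_all
qed

lemma galois_inv_graded:
  "\<beta> \<in> graded_forms m \<Longrightarrow> galois_inv \<beta> \<in> graded_forms m"
  "\<beta> \<in> graded_forms m \<Longrightarrow> galois (galois_inv \<beta>) = \<beta>"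
  using galois_inv_filtered[of \<beta> m "Suc m"] by (simp_all add: filtered_forms_top)

lemma linear_compose_forms:
  assumes "Vector_Spaces.linear form_scale form_scale (F :: ('a \<Rightarrow> 'a \<Rightarrow> 'k) \<Rightarrow> _)"
    "Vector_Spaces.linear form_scale form_scale F'"
  shows "Vector_Spaces.linear form_scale form_scale (\<lambda>\<beta>. F (F' \<beta>))"
  using assms by (simp add: Vector_Spaces.linear_iff)

text \<open>Up to the defect, the two maps are conjugate by \<^const>\<open>galois\<close>.\<close>

lemma trace_sheared_antipode_eq_trace_swap:
  "trace_on form_scale (graded_forms m) sheared_antipode = trace_on form_scale (graded_forms m) swap"
proof -
  let ?W = "graded_forms m" and ?tr = "trace_on form_scale (graded_forms m)"
  obtain A where A: "finite A" "forms.span A = ?W" using finite_span_graded_forms by blast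
  note lin_sg = linear_compose_forms[OF linear_operators(3) linear_operators(2)]
  note lin_gsg = linear_compose_forms[OF linear_operators(1) lin_sg]
  note lin_dg = linear_compose_forms[OF linear_operators(6) linear_operators(2)]
  have "?tr sheared_antipode = ?tr (\<lambda>\<beta>. galois (swap (galois_inv \<beta>)) + cocomm_defect (galois_inv \<beta>))"
  proof (rule forms.trace_on_cong[OF subspace_graded_forms])
    fix \<beta> assume "\<beta> \<in> ?W"
    then show "sheared_antipode \<beta> = galois (swap (galois_inv \<beta>)) + cocomm_defect (galois_inv \<beta>)"
      using sheared_antipode_galois[OF graded_formsD(1), of "galois_inv \<beta>" m] galois_inv_graded[of \<beta> m]
      by (simp add: plus_fun_def)
  qed
  also have "\<dots> = ?tr (\<lambda>\<beta>. galois (swap (galois_inv \<beta>))) + ?tr (\<lambda>\<beta>. cocomm_defect (galois_inv \<beta>))"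
    using galois_graded swap_graded galois_inv_graded(1) cocomm_defect_graded
    by (intro forms.trace_on_add[OF A] lin_gsg lin_dg) simp_all
  also have "?tr (\<lambda>\<beta>. cocomm_defect (galois_inv \<beta>)) = 0"
    using forms.trace_on_lowering_filtration[of A "filtered_forms m" "Suc m", OF A(1) _
        subspace_filtered_forms filtered_forms_mono filtered_forms_0
        lin_dg] A(2)
      cocomm_defect_filtered galois_inv_filtered(1) by (simp add: filtered_forms_top)
  also have "?tr (\<lambda>\<beta>. galois (swap (galois_inv \<beta>))) = ?tr (\<lambda>\<beta>. swap (galois_inv (galois \<beta>)))"
    using galois_graded swap_graded galois_inv_graded(1)
    by (intro forms.trace_on_compose_commute[OF A linear_operators(1) _ lin_sg]) simp_all
  also have "\<dots> = ?tr swap"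
    using galois_inv_galois graded_formsD(1)
    by (intro forms.trace_on_cong[OF subspace_graded_forms]) metis
  finally show ?thesis by simp
qed

text \<open>In \<open>x y_1 \<otimes> S y_2\<close> the part of \<open>y_1\<close> of degree zero gives \<open>x \<otimes> S y\<close>; all other parts raise
the degree of the left factor. The forms that vanish once this degree reaches \<open>n\<close> provide the
filtration.\<close>

lemma trace_sheared_antipode_eq_trace_antipode_snd:
  "trace_on form_scale (graded_forms m) sheared_antipode =
   trace_on form_scale (graded_forms m) antipode_snd"
proof -
  let ?W = "graded_forms m" and ?tr = "trace_on form_scale (graded_forms m)"
  obtain A where A: "finite A" "forms.span A = ?W" using finite_span_graded_forms by blast
  let ?E = "\<lambda>\<beta> x y. sheared_antipode \<beta> x y - antipode_snd \<beta> x y"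
  define U where "U n = {\<beta> \<in> ?W. \<forall>p x y. n \<le> p \<longrightarrow> x \<in> G p \<longrightarrow> \<beta> x y = 0}" for n
  have linE: "Vector_Spaces.linear form_scale form_scale ?E"
    using linear_operators(4,5)
    by (auto simp: linear_form_scale_iff fun_eq_iff algebra_simps)
  have E_graded: "?E \<beta> \<in> ?W" if "\<beta> \<in> ?W" for \<beta>
    using forms.subspace_diff[OF subspace_graded_forms sheared_antipode_graded[OF that]
        antipode_snd_graded[OF that]] by (simp add: fun_diff_def)
  have U_sub: "forms.subspace (U n)" for n
    using subspace_graded_forms[of m] by (auto simp: forms.subspace_def U_def form_scale_def)
  have U_0: "U 0 = {0}"
  proof
    show "{0} \<subseteq> U 0" using forms.subspace_0[OF U_sub] by simp
    show "U 0 \<subseteq> {0}"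
    proof
      fix \<beta> assume "\<beta> \<in> U 0"
      then have "\<beta> = (\<lambda>x y. 0)"
        by (intro bilin_eqI) (auto simp: U_def graded_formsD bilin_def[of "\<lambda>x y. 0"])
      then show "\<beta> \<in> {0}" by (simp add: fun_eq_iff)
    qed
  qed
  have U_top: "U (Suc m) = ?W"
  proof -
    have "\<beta> x y = 0" if "\<beta> \<in> ?W" "Suc m \<le> p" "x \<in> G p" for \<beta> p x y
      using that in_span_components[of y]
      by (intro graded_form_eq_0_span[OF that(1), of x p y 0])
         (auto intro!: span_base simp: atLeast_0)
    then show ?thesis by (auto simp: U_def)
  qed
  have lower: "?E \<beta> \<in> U n" if \<beta>: "\<beta> \<in> U (Suc n)" for \<beta> n
  proof -
    have W: "\<beta> \<in> ?W" using \<beta> by (simp add: U_def)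
    note bil = graded_formsD(1)[OF W]
    have "?E \<beta> x y = 0" if "n \<le> p" "x \<in> G p" for p x y
    proof -
      have kill: "\<beta> (x * u) z = 0" if u: "counit u = 0" for u z
      proof -
        have "x * u \<in> span (\<Union>q\<in>{Suc n..}. G q)"
        proof (rule mult_in_span[OF span_base counit_zero_in_span[OF u]])
          show "x \<in> {x}" by simp
          fix a b assume "a \<in> {x}" "b \<in> (\<Union>m\<in>{1..}. G m)"
          then obtain q where "q \<ge> 1" "a = x" "b \<in> G q" by blast
          then have "a * b \<in> G (p + q)" "Suc n \<le> p + q" using graded_mult \<open>x \<in> G p\<close> \<open>n \<le> p\<close> by auto
          then show "a * b \<in> span (\<Union>q\<in>{Suc n..}. G q)" by (intro span_base) blast
        qed
        moreover have "functional (\<lambda>v. \<beta> v z)" using bil by (simp add: bilin_iff)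
        moreover have "\<beta> v z = 0" if "v \<in> (\<Union>q\<in>{Suc n..}. G q)" for v
          using \<beta> that by (auto simp: U_def)
        ultimately show ?thesis using functional_zero_on_span[of "\<lambda>v. \<beta> v z"] by blast
      qed
      have expand: "\<beta> (x * u) (S w) = counit u * \<beta> x (S w)" for u w
      proof -
        have "counit (u - smul (counit u) 1) = 0"
          using functional_diff[OF functional_counit] by (simp add: counit_scale counit_one)
        then have "\<beta> (x * (u - smul (counit u) 1)) (S w) = 0" by (rule kill)
        moreover have "x * (u - smul (counit u) 1) = x * u - smul (counit u) x"
          by (simp add: right_diff_distrib mult_scale_right)
        moreover have "functional (\<lambda>v. \<beta> v (S w))" using bil by (simp add: bilin_iff)
        ultimately show ?thesis
          by (simp add: functional_diff[of "\<lambda>v. \<beta> v (S w)"] bilin_rules[OF bil])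
      qed
      have "functional (\<lambda>w. \<beta> x (S w))"
        by (simp add: functional_def bilin_rules[OF bil] S_linear)
      then have "sheared_antipode \<beta> x y = \<beta> x (S y)"
        by (simp add: sheared_antipode_def expand cop_counit_left[where f = "\<lambda>w. \<beta> x (S w)"])
      then show ?thesis by (simp add: antipode_snd_def)
    qed
    then show ?thesis using E_graded[OF W] by (auto simp: U_def)
  qed
  have "?tr ?E = 0"
  proof -
    have "trace_on form_scale (U (Suc m)) ?E = 0"
    proof (rule forms.trace_on_lowering_filtration[where F = U and n = "Suc m", OF A(1) _ U_sub _ U_0 linE])
      show "U i \<subseteq> U (Suc i)" for i unfolding U_def using Suc_leD by blast
    qed (use A(2) U_top lower in auto)
    then show ?thesis by (simp add: U_top)
  qed
  moreover have "?tr (\<lambda>\<beta>. ?E \<beta> + antipode_snd \<beta>) = ?tr ?E + ?tr antipode_snd"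
    by (rule forms.trace_on_add[OF A linE E_graded linear_operators(4) antipode_snd_graded])
  moreover have "(\<lambda>\<beta>. ?E \<beta> + antipode_snd \<beta>) = sheared_antipode"
    by (simp add: fun_eq_iff)
  ultimately show ?thesis by simp
qed

lemma trace_antipode_snd:
  "trace_on form_scale (graded_forms m) antipode_snd =
     (\<Sum>p\<le>m. of_nat (dim (G p)) * trace_on smul (G (m - p)) S)"
proof -
  have "(\<Sum>b\<in>hbasis p. \<Sum>c\<in>hbasis q. coord p b b * coord q c (S c)) =
      of_nat (dim (G p)) * trace_on smul (G q) S" for p q
  proof -
    have "trace_on smul (G q) S = (\<Sum>c\<in>hbasis q. coord q c (S c))"
      unfolding trace_on_def hbasis_def[symmetric] Let_def
    proof (rule sum.cong[OF refl])
      fix c assume "c \<in> hbasis q"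
      then have "S c \<in> G q" by (intro antipode_homogeneous[OF antipode] hbasis_in)
      then show "representation (hbasis q) (S c) c = coord q c (S c)"
        by (simp add: coord_homogeneous)
    qed
    then show ?thesis by (simp add: coord_hbasis dim_eq_card_hbasis)
  qed
  then show ?thesis
    by (simp add: trace_on_graded_forms[OF linear_operators(4) antipode_snd_graded]
        antipode_snd_def dual_form_def)
qed

text \<open>The exchange of factors maps \<open>b \<otimes> c\<close> to \<open>c \<otimes> b\<close>, so the diagonal entries come from the vectors
\<open>b \<otimes> b\<close> with \<open>b\<close> in degree \<open>m/2\<close>.\<close>

lemma trace_swap:
  "trace_on form_scale (graded_forms m) swap = (if even m then of_nat (dim (G (m div 2))) else 0)"
proof -
  have inner: "(\<Sum>b\<in>hbasis p. \<Sum>c\<in>hbasis (m - p). coord p b c * coord (m - p) c b) =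
      (if 2 * p = m then of_nat (dim (G p)) else 0)" if "p \<le> m" for p
  proof (cases "2 * p = m")
    case True
    then have "m - p = p" by simp
    then have "(\<Sum>b\<in>hbasis p. \<Sum>c\<in>hbasis (m - p). coord p b c * coord (m - p) c b) =
        (\<Sum>b\<in>hbasis p. \<Sum>c\<in>hbasis p. if c = b then 1 else 0)"
      by (auto intro!: sum.cong simp: coord_hbasis)
    then show ?thesis using True by (simp add: hbasis(3) dim_eq_card_hbasis)
  next
    case False
    then have "p \<noteq> m - p" using that by auto
    then have "coord p b c = 0" if "c \<in> hbasis (m - p)" for b c
      using coord_homogeneous[OF hbasis_in[OF that]] by simp
    then show ?thesis using False by simp
  qed
  have "trace_on form_scale (graded_forms m) swap = (\<Sum>p\<le>m. if 2 * p = m then of_nat (dim (G p)) else 0)"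
    using inner
    by (subst trace_on_graded_forms[OF linear_operators(3) swap_graded])
       (auto intro!: sum.cong simp: swap_def dual_form_def)
  also have "\<dots> = (if even m then of_nat (dim (G (m div 2))) else 0)"
  proof (cases "even m")
    case True
    then have "(\<Sum>p\<le>m. if 2 * p = m then of_nat (dim (G p)) else 0 :: 'k) =
        (\<Sum>p\<le>m. if p = m div 2 then of_nat (dim (G p)) else 0)"
      by (intro sum.cong) auto
    then show ?thesis using True by simp
  qed (auto intro!: sum.neutral)
  finally show ?thesis .
qed

text \<open>In terms of generating series, \<open>(\<Sum>a_m z^m) * h z = h (z^2)\<close>.\<close>

theorem trace_antipode_convolution:
  "(\<Sum>p\<le>m. of_nat (dim (G p)) * trace_on smul (G (m - p)) S) =
     (if even m then of_nat (dim (G (m div 2))) else 0)"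
  using trace_sheared_antipode_eq_trace_swap[of m] trace_sheared_antipode_eq_trace_antipode_snd[of m]
  by (simp add: trace_antipode_snd trace_swap)

end

section \<open>Coefficient asymptotics\<close>

lemma binomial_shift_asymptotic:
  "(\<lambda>n. real ((n + e) choose e) / real n ^ e) \<longlonglongrightarrow> 1 / fact e"
proof (induction e)
  case (Suc e)
  have "(\<lambda>n. real ((n + e) choose e) / real n ^ e * (real (n + Suc e) / real n) / real (Suc e))
      \<longlonglongrightarrow> 1 / fact e * 1 / real (Suc e)"
  proof (intro Suc tendsto_divide tendsto_mult tendsto_const)
    show "(\<lambda>n. real (n + Suc e) / real n) \<longlonglongrightarrow> 1" by real_asymp
  qed auto
  moreover have "real ((n + e) choose e) / real n ^ e * (real (n + Suc e) / real n) / real (Suc e) =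
      real ((n + Suc e) choose Suc e) / real n ^ Suc e" for n
  proof -
    have "real (Suc e) * real ((n + Suc e) choose Suc e) = real (n + Suc e) * real ((n + e) choose e)"
      using Suc_times_binomial[of e "n + e"] by (metis add_Suc_right of_nat_mult)
    then have eq: "real ((n + Suc e) choose Suc e) = real (n + Suc e) * real ((n + e) choose e) / real (Suc e)"
      by (simp add: eq_divide_eq mult.commute del: binomial_Suc_Suc of_nat_Suc add_Suc_right)
    show ?thesis unfolding eq by (simp add: mult_ac del: of_nat_Suc add_Suc_right)
  qed
  ultimately show ?case by (simp add: mult.commute)
qed simp

lemma binomial_shift_ratio:
  assumes "filterlim f at_top sequentially" "filterlim g at_top sequentially"
    and "(\<lambda>n. real (f n) / real (g n)) \<longlonglongrightarrow> x"
  shows "(\<lambda>n. real ((f n + e) choose e) / real ((g n + e) choose e)) \<longlonglongrightarrow> x ^ e"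
proof -
  let ?c = "\<lambda>n. real ((n + e) choose e) / real n ^ e"
  have "(\<lambda>n. ?c (f n) / ?c (g n) * (real (f n) / real (g n)) ^ e) \<longlonglongrightarrow>
      (1 / fact e) / (1 / fact e) * x ^ e"
    by (intro assms(3) filterlim_compose[OF binomial_shift_asymptotic assms(1)]
        filterlim_compose[OF binomial_shift_asymptotic assms(2)]
        tendsto_divide tendsto_mult tendsto_power) simp
  moreover have "eventually (\<lambda>n. f n > 0 \<and> g n > 0) sequentially"
    using eventually_compose_filterlim[OF eventually_gt_at_top[of 0] assms(1)]
      eventually_compose_filterlim[OF eventually_gt_at_top[of 0] assms(2)]
    by (rule eventually_conj)
  then have "eventually (\<lambda>n. ?c (f n) / ?c (g n) * (real (f n) / real (g n)) ^ e =
      real ((f n + e) choose e) / real ((g n + e) choose e)) sequentially"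
    by eventually_elim (simp add: field_simps power_divide)
  ultimately show ?thesis
    by (simp add: tendsto_cong)
qed

text \<open>The numbers \<open>((n + e) choose e) * t ^ n\<close> are the coefficients of \<open>1 / (1 - t z)^(e+1)\<close>. So this
is the transfer of the behaviour at the pole \<open>1/t\<close> to coefficients: the numerator only enters
through its value at \<open>1/t\<close>. Termwise the quotients of binomial coefficients tend to one, and they
are bounded by one, so that Tannery's theorem applies.\<close>

lemma tendsto_convolution_binomial:
  fixes u :: "nat \<Rightarrow> complex" and t :: real and e :: nat
  assumes t: "t > 0" and u: "summable (\<lambda>k. norm (u k) / t ^ k)"
  defines "c \<equiv> \<lambda>n. real ((n + e) choose e)"
  shows "(\<lambda>n. (\<Sum>k\<le>n. u k * of_real (c (n - k) * t ^ (n - k))) / of_real (c n * t ^ n))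
    \<longlonglongrightarrow> suminf (\<lambda>k. u k / of_real t ^ k)"
proof -
  define a where "a = (\<lambda>k n. if k \<le> n then u k / of_real t ^ k * of_real (c (n - k) / c n) else 0)"
  have c_pos: "c n > 0" for n by (simp add: c_def)
  have mono: "c (n - k) \<le> c n" for n k
    unfolding c_def by (intro of_nat_mono binomial_right_mono) auto
  have "(\<lambda>n. suminf (\<lambda>k. a k n)) \<longlonglongrightarrow> suminf (\<lambda>k. u k / of_real t ^ k)"
  proof (intro tannerys_theorem[THEN conjunct2, THEN conjunct2])
    fix k
    have "(\<lambda>n. c (n - k) / c n) \<longlonglongrightarrow> 1 ^ e"
      unfolding c_def
    proof (rule binomial_shift_ratio)
      show "filterlim (\<lambda>n. n - k) at_top sequentially"
        by (rule filterlim_minus_const_nat_at_top)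
      show "(\<lambda>n. real (n - k) / real n) \<longlonglongrightarrow> 1"
      proof (rule Lim_transform_eventually)
        show "(\<lambda>n. (real n - real k) / real n) \<longlonglongrightarrow> 1" by real_asymp
        show "\<forall>\<^sub>F n in sequentially. (real n - real k) / real n = real (n - k) / real n"
          using eventually_ge_at_top[of k] by eventually_elim (simp add: of_nat_diff)
      qed
    qed (rule filterlim_ident)
    then have "(\<lambda>n. u k / of_real t ^ k * of_real (c (n - k) / c n)) \<longlonglongrightarrow> u k / of_real t ^ k * of_real 1"
      by (intro tendsto_intros) simp
    moreover have "\<forall>\<^sub>F n in sequentially. u k / of_real t ^ k * of_real (c (n - k) / c n) = a k n"
      using eventually_ge_at_top[of k] by eventually_elim (simp add: a_def)
    ultimately show "(\<lambda>n. a k n) \<longlonglongrightarrow> u k / of_real t ^ k"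
      by (auto intro: Lim_transform_eventually)
  next
    have "norm (a k n) \<le> norm (u k) / t ^ k" for k n
    proof -
      have "norm (u k) / t ^ k * (c (n - k) / c n) \<le> norm (u k) / t ^ k * 1"
        using mono c_pos t by (intro mult_left_mono) (auto simp: divide_le_eq_1)
      then show ?thesis
        using t c_pos[of n] c_pos[of "n - k"] by (auto simp: a_def norm_mult norm_divide norm_power)
    qed
    then show "\<forall>\<^sub>F (k, n) in at_top \<times>\<^sub>F sequentially. norm (a k n) \<le> norm (u k) / t ^ k"
      by (simp add: case_prod_unfold)
  qed (use u in auto)
  also have "(\<lambda>n. suminf (\<lambda>k. a k n)) =
      (\<lambda>n. (\<Sum>k\<le>n. u k * of_real (c (n - k) * t ^ (n - k))) / of_real (c n * t ^ n))"
  proof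
    fix n
    have "suminf (\<lambda>k. a k n) = (\<Sum>k\<le>n. a k n)"
      by (rule suminf_finite) (auto simp: a_def)
    also have "\<dots> = (\<Sum>k\<le>n. u k * of_real (c (n - k) * t ^ (n - k)) / of_real (c n * t ^ n))"
    proof (rule sum.cong[OF refl])
      fix k assume "k \<in> {..n}"
      then have "t ^ n = t ^ k * t ^ (n - k)" by (simp add: power_add[symmetric])
      then show "a k n = u k * of_real (c (n - k) * t ^ (n - k)) / of_real (c n * t ^ n)"
        using \<open>k \<in> {..n}\<close> t c_pos[of n] by (simp add: a_def)
    qed
    finally show "suminf (\<lambda>k. a k n) =
        (\<Sum>k\<le>n. u k * of_real (c (n - k) * t ^ (n - k))) / of_real (c n * t ^ n)"
      by (simp add: sum_divide_distrib)
  qed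
  finally show ?thesis .
qed

lemma tendsto_even_odd:
  fixes f :: "nat \<Rightarrow> 'b::topological_space"
  assumes "(\<lambda>n. f (2 * n)) \<longlonglongrightarrow> l" "(\<lambda>n. f (2 * n + 1)) \<longlonglongrightarrow> l"
  shows "f \<longlonglongrightarrow> l"
proof (rule topological_tendstoI)
  fix S assume "open S" "l \<in> S"
  then obtain M N where M: "\<And>n. n \<ge> M \<Longrightarrow> f (2 * n) \<in> S" and N: "\<And>n. n \<ge> N \<Longrightarrow> f (2 * n + 1) \<in> S"
    using topological_tendstoD[OF assms(1)] topological_tendstoD[OF assms(2)]
    unfolding eventually_sequentially by metis
  have "f m \<in> S" if "m \<ge> 2 * M + 2 * N + 1" for m
  proof (cases "even m")
    case True
    then show ?thesis using M[of "m div 2"] that by auto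
  next
    case False
    then have "m = 2 * (m div 2) + 1" "m div 2 \<ge> N" using that by presburger+
    then show ?thesis using N[of "m div 2"] by metis
  qed
  then show "eventually (\<lambda>m. f m \<in> S) sequentially"
    unfolding eventually_sequentially by blast
qed

text \<open>The quotients of binomial coefficients at \<open>n\<close> and at \<open>2 n\<close> or \<open>2 n + 1\<close> tend to \<open>2^(-e)\<close>.
Together with the factor \<open>1/2\<close> in the even and odd parts this makes up \<open>2^(-(e+1))\<close>.\<close>

lemma ratio_asymptotics:
  fixes d A :: "nat \<Rightarrow> complex" and R r :: real and P Q g :: complex and e :: nat
  assumes r: "r > 0" "R = r ^ 2" and ne: "g \<noteq> 0" "P + Q \<noteq> 0" "P - Q \<noteq> 0"
  defines "c \<equiv> \<lambda>n. real ((n + e) choose e)"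
  assumes d: "(\<lambda>m. d m / of_real (c m * (1 / R) ^ m)) \<longlonglongrightarrow> g"
    and even: "(\<lambda>n. A (2 * n) / of_real (c n * (1 / R) ^ n)) \<longlonglongrightarrow> g * (P + Q) / 2"
    and odd: "(\<lambda>n. A (2 * n + 1) / of_real (c n * (1 / R) ^ n)) \<longlonglongrightarrow> g * (P - Q) / (2 * of_real r)"
  shows "(\<lambda>m. A m / d m / (of_real (r ^ m) / 2 ^ Suc e * (P + (-1) ^ m * Q))) \<longlonglongrightarrow> 1"
proof (rule tendsto_even_odd)
  have c_pos: "c n > 0" for n by (simp add: c_def)
  then have c_ne: "c n \<noteq> 0" for n by (metis less_irrefl)
  have at_top: "filterlim (\<lambda>n::nat. 2 * n) at_top sequentially" "filterlim (\<lambda>n::nat. 2 * n + 1) at_top sequentially"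
    by real_asymp+
  have "(\<lambda>n. c n / c (2 * n)) \<longlonglongrightarrow> (1 / 2) ^ e"
    unfolding c_def by (intro binomial_shift_ratio at_top filterlim_ident) real_asymp
  then have c_even: "(\<lambda>n. complex_of_real (c n / c (2 * n))) \<longlonglongrightarrow> of_real ((1 / 2) ^ e)"
    by (rule tendsto_of_real)
  have "(\<lambda>n. c n / c (2 * n + 1)) \<longlonglongrightarrow> (1 / 2) ^ e"
    unfolding c_def by (intro binomial_shift_ratio at_top filterlim_ident) real_asymp
  then have c_odd: "(\<lambda>n. complex_of_real (c n / c (2 * n + 1))) \<longlonglongrightarrow> of_real ((1 / 2) ^ e)"
    by (rule tendsto_of_real)
  have "(\<lambda>n. A (2 * n) / of_real (c n * (1 / R) ^ n) / (d (2 * n) / of_real (c (2 * n) * (1 / R) ^ (2 * n)))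
      * of_real (c n / c (2 * n)) * (2 ^ Suc e / (P + Q)))
    \<longlonglongrightarrow> g * (P + Q) / 2 / g * of_real ((1 / 2) ^ e) * (2 ^ Suc e / (P + Q))"
    using filterlim_compose[OF d at_top(1)] ne
    by (intro tendsto_intros even c_even) auto
  moreover have "A (2 * n) / of_real (c n * (1 / R) ^ n) / (d (2 * n) / of_real (c (2 * n) * (1 / R) ^ (2 * n)))
      * of_real (c n / c (2 * n)) * (2 ^ Suc e / (P + Q)) =
      A (2 * n) / d (2 * n) / (of_real (r ^ (2 * n)) / 2 ^ Suc e * (P + (-1) ^ (2 * n) * Q))" for n
  proof -
    have "r ^ (2 * n) = R ^ n" "R ^ (2 * n) = R ^ n * R ^ n" "R \<noteq> 0"
      using r by (simp_all add: power_mult power2_eq_square power_mult_distrib)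
    then show ?thesis
      using c_ne by (simp add: power_divide field_simps)
  qed
  moreover have "g * (P + Q) / 2 / g * of_real ((1 / 2) ^ e) * (2 ^ Suc e / (P + Q)) = 1"
    using ne by (simp add: power_divide)
  ultimately show "(\<lambda>n. A (2 * n) / d (2 * n) /
      (of_real (r ^ (2 * n)) / 2 ^ Suc e * (P + (-1) ^ (2 * n) * Q))) \<longlonglongrightarrow> 1"
    by simp
  have "(\<lambda>n. A (2 * n + 1) / of_real (c n * (1 / R) ^ n) / (d (2 * n + 1) / of_real (c (2 * n + 1) * (1 / R) ^ (2 * n + 1)))
      * of_real (c n / c (2 * n + 1)) * (of_real r * 2 ^ Suc e / (P - Q)))
    \<longlonglongrightarrow> g * (P - Q) / (2 * of_real r) / g * of_real ((1 / 2) ^ e) * (of_real r * 2 ^ Suc e / (P - Q))"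
    using filterlim_compose[OF d at_top(2)] ne
    by (intro tendsto_intros odd c_odd) auto
  moreover have "A (2 * n + 1) / of_real (c n * (1 / R) ^ n) / (d (2 * n + 1) / of_real (c (2 * n + 1) * (1 / R) ^ (2 * n + 1)))
      * of_real (c n / c (2 * n + 1)) * (of_real r * 2 ^ Suc e / (P - Q)) =
      A (2 * n + 1) / d (2 * n + 1) / (of_real (r ^ (2 * n + 1)) / 2 ^ Suc e * (P + (-1) ^ (2 * n + 1) * Q))" for n
  proof -
    define \<rho> where "\<rho> = complex_of_real (r ^ (2 * n))"
    have "\<rho> \<noteq> 0" using r by (simp add: \<rho>_def)
    have e1: "of_real (c n * (1 / R) ^ n) = of_real (c n) / \<rho>"
      by (simp add: r(2) \<rho>_def power_divide power_mult)
    have e2: "of_real (c (2 * n + 1) * (1 / R) ^ (2 * n + 1)) =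
        of_real (c (2 * n + 1)) / (\<rho> * \<rho> * of_real r * of_real r)"
    proof -
      have "R ^ (2 * n + 1) = r ^ (2 * n) * r ^ (2 * n) * r * r"
        by (simp add: r(2) power2_eq_square power_mult_distrib mult_ac)
      then show ?thesis by (simp add: \<rho>_def power_divide del: power_Suc)
    qed
    have e3: "complex_of_real (r ^ (2 * n + 1)) = \<rho> * of_real r"
      by (simp add: \<rho>_def mult.commute)
    define \<delta> where "\<delta> = P - Q"
    have e4: "P + (-1) ^ (2 * n + 1) * Q = \<delta>" and "\<delta> \<noteq> 0"
      using ne(3) by (simp_all add: \<delta>_def)
    show ?thesis
      unfolding e1 e2 e3 e4 \<delta>_def[symmetric] using \<open>\<delta> \<noteq> 0\<close> c_ne[of n] c_ne[of "2 * n + 1"] r \<open>\<rho> \<noteq> 0\<close>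
      by (simp add: field_simps)
  qed
  moreover have "g * (P - Q) / (2 * of_real r) / g * of_real ((1 / 2) ^ e) * (of_real r * 2 ^ Suc e / (P - Q)) = 1"
    using ne r by (simp add: power_divide)
  ultimately show "(\<lambda>n. A (2 * n + 1) / d (2 * n + 1) /
      (of_real (r ^ (2 * n + 1)) / 2 ^ Suc e * (P + (-1) ^ (2 * n + 1) * Q))) \<longlonglongrightarrow> 1"
    by simp
qed

lemma inverse_one_minus_power_nth:
  fixes t :: complex
  shows "inverse ((1 - fps_const t * fps_X) ^ Suc e) = Abs_fps (\<lambda>k. of_nat ((k + e) choose e) * t ^ k)"
proof -
  have "Suc e + k - 1 choose k = (k + e) choose e" for k
    using binomial_symmetric[of e "k + e"] by (simp add: add.commute)
  then show ?thesis
    using one_minus_const_fps_X_neg_power'[of "Suc e" t] by simp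
qed

lemma fps_nth_of_mult_power:
  fixes F U :: "complex fps" and t :: real
  assumes "F * (1 - fps_const (of_real t) * fps_X) ^ Suc e = U"
  shows "F $ n = (\<Sum>k\<le>n. U $ k * of_real (real ((n - k + e) choose e) * t ^ (n - k)))"
proof -
  let ?P = "(1 - fps_const (complex_of_real t) * fps_X) ^ Suc e"
  have "?P $ 0 \<noteq> 0" by (simp add: fps_nth_power_0)
  then have "F = U * inverse ?P"
    unfolding assms[symmetric] by (simp add: mult.assoc inverse_mult_eq_1' del: power_Suc)
  then show ?thesis
    unfolding inverse_one_minus_power_nth by (simp add: fps_mult_nth atLeast0AtMost)
qed

text \<open>Division by a series in \<open>z^2\<close> acts separately on the even part (\<open>i = 0\<close>) and the odd part
(\<open>i = 1\<close>). In this way two poles of the same modulus and order reduce to the case of one pole.\<close>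

lemma fps_nth_of_mult_power_square:
  fixes F U :: "complex fps" and t :: real
  assumes "F * (1 - fps_const (of_real t) * fps_X ^ 2) ^ Suc e = U" and i: "i < 2"
  shows "F $ (2 * n + i) =
    (\<Sum>k\<le>n. U $ (2 * k + i) * of_real (real ((n - k + e) choose e) * t ^ (n - k)))"
proof -
  let ?P = "(1 - fps_const (complex_of_real t) * fps_X) ^ Suc e"
  have P2: "(1 - fps_const (of_real t) * fps_X ^ 2) ^ Suc e = ?P oo fps_X ^ 2"
    by (simp add: fps_compose_power[symmetric] fps_compose_sub_distrib fps_compose_mult_distrib
        del: power_Suc)
  have "?P $ 0 \<noteq> 0" by (simp add: fps_nth_power_0)
  then have "?P * inverse ?P = 1" by (rule inverse_mult_eq_1')
  then have "(?P oo fps_X ^ 2) * (inverse ?P oo fps_X ^ 2) = 1"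
    by (simp add: fps_compose_mult_distrib[symmetric] del: power_Suc)
  then have "F = U * (inverse ?P oo fps_X ^ 2)"
    unfolding assms(1)[symmetric] P2 by (simp add: mult.assoc)
  then have "F $ (2 * n + i) = (\<Sum>j\<le>2 * n + i. U $ j * (if 2 dvd (2 * n + i - j) then
      of_real (real (((2 * n + i - j) div 2 + e) choose e) * t ^ ((2 * n + i - j) div 2)) else 0))"
    unfolding inverse_one_minus_power_nth
    by (simp add: fps_mult_nth fps_nth_compose_X_power atLeast0AtMost if_distrib cong: if_cong)
  also have "\<dots> = (\<Sum>j\<in>(\<lambda>k. 2 * k + i) ` {..n}. U $ j * (if 2 dvd (2 * n + i - j) then
      of_real (real (((2 * n + i - j) div 2 + e) choose e) * t ^ ((2 * n + i - j) div 2)) else 0))"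
  proof (intro sum.mono_neutral_right ballI)
    fix j assume j: "j \<in> {..2 * n + i} - (\<lambda>k. 2 * k + i) ` {..n}"
    have "\<not> 2 dvd (2 * n + i - j)"
    proof
      assume "2 dvd (2 * n + i - j)"
      then obtain k where "2 * n + i - j = 2 * k" by (elim dvdE)
      then have "j = 2 * (n - k) + i" "n - k \<le> n" using i j by auto
      then show False using j by blast
    qed
    then show "U $ j * (if 2 dvd (2 * n + i - j) then
      of_real (real (((2 * n + i - j) div 2 + e) choose e) * t ^ ((2 * n + i - j) div 2)) else 0) = 0"
      by simp
  qed (use i in auto)
  also have "\<dots> = (\<Sum>k\<le>n. U $ (2 * k + i) * of_real (real ((n - k + e) choose e) * t ^ (n - k)))"
    by (subst sum.reindex) (auto simp: inj_on_def diff_mult_distrib2[symmetric] intro!: sum.cong)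
  finally show ?thesis .
qed

lemma sums_even_odd_parts:
  fixes u :: "nat \<Rightarrow> complex"
  assumes x: "(\<lambda>k. u k * z ^ k) sums x" and y: "(\<lambda>k. u k * (- z) ^ k) sums y"
  shows "(\<lambda>k. u (2 * k) * z ^ (2 * k)) sums ((x + y) / 2)"
    and "(\<lambda>k. u (2 * k + 1) * z ^ (2 * k + 1)) sums ((x - y) / 2)"
proof -
  have zero: "u n * z ^ n + u n * (- z) ^ n = 0" if "n \<notin> range (\<lambda>k. 2 * k)" for n
  proof -
    have "odd n" using that by (auto elim!: evenE)
    then show ?thesis by simp
  qed
  have "(\<lambda>k. (u k * z ^ k + u k * (- z) ^ k) / 2) sums ((x + y) / 2)"
    by (intro sums_divide sums_add x y)
  then have "(\<lambda>k. (u (2 * k) * z ^ (2 * k) + u (2 * k) * (- z) ^ (2 * k)) / 2) sums ((x + y) / 2)"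
    by (subst sums_mono_reindex[of "\<lambda>k. 2 * k"]) (use zero in \<open>auto simp: strict_mono_def\<close>)
  then show "(\<lambda>k. u (2 * k) * z ^ (2 * k)) sums ((x + y) / 2)" by simp
  have zero': "u n * z ^ n - u n * (- z) ^ n = 0" if "n \<notin> range (\<lambda>k. 2 * k + 1)" for n
  proof -
    have "even n" using that by (metis oddE rangeI)
    then show ?thesis by simp
  qed
  have "(\<lambda>k. (u k * z ^ k - u k * (- z) ^ k) / 2) sums ((x - y) / 2)"
    by (intro sums_divide sums_diff x y)
  then have "(\<lambda>k. (u (2 * k + 1) * z ^ (2 * k + 1) - u (2 * k + 1) * (- z) ^ (2 * k + 1)) / 2) sums ((x - y) / 2)"
    by (subst sums_mono_reindex[of "\<lambda>k. 2 * k + 1"]) (use zero' in \<open>auto simp: strict_mono_def\<close>)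
  then show "(\<lambda>k. u (2 * k + 1) * z ^ (2 * k + 1)) sums ((x - y) / 2)" by (simp add: mult_ac)
qed

text \<open>The extra room beyond the closed disc gives absolute convergence of the Taylor series on its boundary
circle.\<close>

lemma analytic_on_cball_extends:
  assumes "f analytic_on cball 0 r" "r \<ge> 0"
  obtains \<rho> where "\<rho> > r" "f holomorphic_on ball (0 :: complex) \<rho>"
proof -
  obtain S where S: "open S" "cball 0 r \<subseteq> S" "f holomorphic_on S"
    using assms(1) unfolding analytic_on_holomorphic by blast
  obtain \<epsilon> where \<epsilon>: "\<epsilon> > 0" "(\<Union>x\<in>cball 0 r. ball x \<epsilon>) \<subseteq> S"
    using compact_subset_open_imp_ball_epsilon_subset[OF compact_cball S(1,2)] by blast
  have "ball (0 :: complex) (r + \<epsilon>) \<subseteq> (\<Union>x\<in>cball 0 r. ball x \<epsilon>)"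
  proof
    fix z :: complex assume z: "z \<in> ball 0 (r + \<epsilon>)"
    show "z \<in> (\<Union>x\<in>cball 0 r. ball x \<epsilon>)"
    proof (cases "norm z \<le> r")
      case True
      then show ?thesis using \<epsilon>(1) by force
    next
      case False
      define x where "x = of_real (r / norm z) * z"
      have nz: "norm z > 0" using False assms(2) by linarith
      have nx: "norm x = r" using nz assms(2) by (simp add: x_def norm_mult norm_divide)
      have "z - x = of_real (1 - r / norm z) * z" by (simp add: x_def algebra_simps)
      then have "norm (z - x) = \<bar>1 - r / norm z\<bar> * norm z" by (simp only: norm_mult norm_of_real)
      moreover have "\<bar>1 - r / norm z\<bar> = 1 - r / norm z" using nz False by (simp add: abs_if divide_le_eq)
      ultimately have "norm (z - x) = norm z - r"
        using nz by (simp add: left_diff_distrib)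
      then show ?thesis
        using z nx by (intro UN_I[of x]) (auto simp: dist_norm norm_minus_commute)
    qed
  qed
  then have "f holomorphic_on ball 0 (r + \<epsilon>)"
    using \<epsilon>(2) S(3) by (meson holomorphic_on_subset subset_trans)
  then show thesis using that[of "r + \<epsilon>"] \<epsilon>(1) by simp
qed

text \<open>A nicely meromorphic function takes the value zero at its poles, and the inverse of zero is zero.\<close>

lemma recip_value_eq_inverse:
  assumes "h nicely_meromorphic_on UNIV"
  shows "recip_value h = (\<lambda>z. inverse (h z))"
proof
  fix z
  have "h z = 0" if "is_pole h z"
    using assms that not_tendsto_and_filterlim_at_infinity[of "at z" h "h z"]
    by (auto simp: nicely_meromorphic_on_def is_pole_def)
  then show "recip_value h z = inverse (h z)"
    by (simp add: recip_value_def divide_inverse)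
qed

lemma recip_value_analytic:
  assumes "h nicely_meromorphic_on UNIV" "\<not> is_pole h z \<Longrightarrow> h z \<noteq> 0"
  shows "recip_value h analytic_on {z}"
proof -
  have "\<not> is_pole (\<lambda>w. inverse (h w)) z"
  proof
    assume "is_pole (\<lambda>w. inverse (h w)) z"
    then have "isolated_zero h z" by (simp add: is_pole_inverse_iff)
    then have lim: "h \<midarrow>z\<rightarrow> 0" by (simp add: isolated_zero_def)
    show False
    proof (cases "is_pole h z")
      case True
      then show False
        using lim not_tendsto_and_filterlim_at_infinity[of "at z" h 0] by (simp add: is_pole_def)
    next
      case False
      then have "h \<midarrow>z\<rightarrow> h z" using assms(1) by (auto simp: nicely_meromorphic_on_def)
      then show False using lim assms(2)[OF False] tendsto_unique[of "at z" h] by auto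
    qed
  qed
  then show ?thesis
    unfolding recip_value_eq_inverse[OF assms(1)]
    using nicely_meromorphic_on_imp_analytic_at[OF nicely_meromorphic_on_inverse[OF assms(1)]] by simp
qed

text \<open>Multiplication by the factor of the pole, with the leading Laurent coefficient as value at the pole,
gives a function that agrees with \<^const>\<open>zor_poly\<close> near the pole.\<close>

lemma analytic_remove_pole:
  assumes iso: "isolated_singularity_at h c" and pole: "is_pole h c" and n: "zorder h c = - int n"
  defines "g \<equiv> \<lambda>w. if w = c then zor_poly h c c else h w * (w - c) ^ n"
  shows "g analytic_on {c}" "g c \<noteq> 0" "n > 0"
proof -
  obtain r where r: "r > 0" "h analytic_on ball c r - {c}"
    using iso unfolding isolated_singularity_at_def by blast
  then have "h holomorphic_on ball c r - {c}" by (simp add: analytic_imp_holomorphic)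
  then have *: "zorder h c < 0 \<and> zor_poly h c c \<noteq> 0 \<and>
      (\<exists>s>0. cball c s \<subseteq> ball c r \<and> zor_poly h c holomorphic_on cball c s \<and>
        (\<forall>w\<in>cball c s - {c}. h w = zor_poly h c w / (w - c) ^ nat (- zorder h c) \<and> zor_poly h c w \<noteq> 0))"
    using r(1) pole by (intro zorder_exist_pole) auto
  then show "g c \<noteq> 0" "n > 0" by (simp_all add: g_def n)
  obtain s where s: "s > 0" "zor_poly h c holomorphic_on cball c s"
    "\<And>w. w \<in> cball c s - {c} \<Longrightarrow> h w = zor_poly h c w / (w - c) ^ n"
    using * n by auto
  have "g w = zor_poly h c w" if "w \<in> cball c s" for w
    using s(3)[of w] that by (auto simp: g_def)
  then have "g holomorphic_on ball c s"
    using holomorphic_on_subset[OF s(2) ball_subset_cball] holomorphic_cong[of "ball c s" "ball c s" g "zor_poly h c"]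
    by auto
  then show "g analytic_on {c}"
    using s(1) by (intro holomorphic_on_imp_analytic_at[of _ "ball c s"]) auto
qed

text \<open>The analytic half of the argument: the convolution identity between the two sequences stands for the
Hopf algebra. The bound \<open>R \<le> 1\<close> follows from \<open>R \<le> R powr (1/4)\<close>, which is part of the assumption that
\<open>R\<close> is the singularity in the larger disc. For \<open>R = 1\<close> the point \<open>\<surd>R\<close> is the pole itself and its
reciprocal value is zero, so the same computation applies.\<close>

theorem convolution_ratio_asymptotics:
  fixes h :: "complex \<Rightarrow> complex" and R :: real and \<gamma> :: nat and d :: "nat \<Rightarrow> nat" and a :: "nat \<Rightarrow> int"
  assumes meromorphic: "h nicely_meromorphic_on UNIV"
    and taylor: "h has_fps_expansion Abs_fps (\<lambda>m. of_nat (d m))"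
    and d0: "d 0 \<noteq> 0"
    and conv: "\<And>m. (\<Sum>p\<le>m. int (d p) * a (m - p)) = (if even m then int (d (m div 2)) else 0)"
    and R_pos: "0 < R"
    and R_pole: "is_pole h (of_real R)"
    and R_unique: "{z. is_pole h z \<and> cmod z \<le> R powr (1/4)} = {of_real R}"
    and order: "zorder h (of_real R) = - int \<gamma>"
    and nonzero: "\<And>z. cmod z \<le> sqrt R \<Longrightarrow> \<not> is_pole h z \<Longrightarrow> h z \<noteq> 0"
    and not_pm: "\<not> is_pole h (of_real (sqrt R)) \<Longrightarrow>
          h (- of_real (sqrt R)) \<noteq> h (of_real (sqrt R)) \<and>
          h (- of_real (sqrt R)) \<noteq> - h (of_real (sqrt R))"
  shows "(\<lambda>m. (of_int (a m) / of_nat (d m)) /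
           (of_real (R powr (real m / 2)) / 2 ^ \<gamma> *
              (recip_value h (of_real (sqrt R)) +
               (-1) ^ m * recip_value h (- of_real (sqrt R)))))
        \<longlonglongrightarrow> (1 :: complex)"
proof -
  define r where "r = sqrt R"
  have r: "r > 0" "R = r ^ 2" using R_pos by (simp_all add: r_def)
  have pole_iff: "is_pole h z \<longleftrightarrow> z = of_real R" if "cmod z \<le> R powr (1/4)" for z
    using R_unique that by blast
  have "complex_of_real R \<in> {z. is_pole h z \<and> cmod z \<le> R powr (1/4)}"
    unfolding R_unique by simp
  then have R_mem: "R \<le> R powr (1/4)" using R_pos by simp
  have R_le_1: "R \<le> 1"
  proof (rule ccontr)
    assume "\<not> R \<le> 1"
    then have "R powr (1/4) < R powr 1" by (intro powr_less_mono) auto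
    then show False using R_mem R_pos by simp
  qed
  have r_le: "r \<le> R powr (1/4)"
  proof -
    have "r = R powr (1/2)" using R_pos by (simp add: r_def powr_half_sqrt)
    also have "\<dots> \<le> R powr (1/4)" using R_pos R_le_1 by (intro powr_mono') auto
    finally show ?thesis .
  qed
  have f: "recip_value h analytic_on cball 0 r"
  proof -
    have "recip_value h analytic_on {z}" if "z \<in> cball 0 r" for z
      using that nonzero[of z] by (intro recip_value_analytic meromorphic) (auto simp: r_def)
    then show ?thesis using analytic_on_analytic_at by blast
  qed
  obtain \<rho>1 where \<rho>1: "\<rho>1 > r" "recip_value h holomorphic_on ball 0 \<rho>1"
    using analytic_on_cball_extends[OF f] r(1) by auto
  \<comment> \<open>\<open>g0\<close> removes the pole; \<open>g\<close> rescales it so that \<open>g w = h w * (1 - w/R) ^ \<gamma>\<close> near zero.\<close>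
  define g0 where "g0 = (\<lambda>w. if w = of_real R then zor_poly h (of_real R) (of_real R)
      else h w * (w - of_real R) ^ \<gamma>)"
  define g where "g = (\<lambda>w. g0 w * (- 1 / of_real R) ^ \<gamma>)"
  have iso: "isolated_singularity_at h (of_real R)"
    using meromorphic by (auto simp: nicely_meromorphic_on_def intro: meromorphic_on_isolated_singularity meromorphic_on_subset)
  note g0R = analytic_remove_pole[OF iso R_pole order, folded g0_def]
  have gR: "g (of_real R) \<noteq> 0" using g0R(2) R_pos by (simp add: g_def g0_def)
  have "g0 analytic_on {w}" if "w \<in> cball 0 R" for w
  proof (cases "w = of_real R")
    case False
    have "h analytic_on {w}"
      using False pole_iff[of w] that R_mem
      by (intro nicely_meromorphic_on_imp_analytic_at[OF meromorphic]) auto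
    then have "(\<lambda>w. h w * (w - of_real R) ^ \<gamma>) analytic_on {w}"
      by (intro analytic_intros)
    moreover have "eventually (\<lambda>w. w \<noteq> of_real R) (nhds w)"
      using False by (intro t1_space_nhds)
    then have "eventually (\<lambda>w. g0 w = h w * (w - of_real R) ^ \<gamma>) (nhds w)"
      by eventually_elim (simp add: g0_def)
    ultimately show ?thesis by (simp add: analytic_at_cong)
  qed (use g0R(1) in simp)
  then have "g0 analytic_on cball 0 R" using analytic_on_analytic_at by blast
  then have "g analytic_on cball 0 R" unfolding g_def by (intro analytic_intros)
  then obtain \<rho>2 where \<rho>2: "\<rho>2 > R" "g holomorphic_on ball 0 \<rho>2"
    using analytic_on_cball_extends R_pos by (metis less_imp_le)
  obtain e where e: "\<gamma> = Suc e" using g0R(3) gr0_implies_Suc by blast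
  define c where "c = (\<lambda>n. real ((n + e) choose e))"

  define D A where "D = Abs_fps (\<lambda>m. complex_of_nat (d m))" and "A = Abs_fps (\<lambda>m. complex_of_int (a m))"
  define U where "U = D * (1 - fps_const (of_real (1 / R)) * fps_X) ^ \<gamma>"
  define V where "V = (U oo fps_X ^ 2) * inverse D"
  have D0: "D $ 0 \<noteq> 0" using d0 by (simp add: D_def)
  have AD: "A * D = D oo fps_X ^ 2"
  proof (rule fps_ext)
    fix m
    have "(A * D) $ m = (\<Sum>p\<le>m. of_nat (d p) * of_int (a (m - p)))"
      by (subst mult.commute) (simp add: A_def D_def fps_mult_nth atLeast0AtMost)
    also have "\<dots> = of_int (\<Sum>p\<le>m. int (d p) * a (m - p))" by simp
    also have "\<dots> = (D oo fps_X ^ 2) $ m"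
      unfolding conv by (simp add: fps_nth_compose_X_power D_def)
    finally show "(A * D) $ m = (D oo fps_X ^ 2) $ m" .
  qed
  have AV: "A * (1 - fps_const (of_real (1 / R)) * fps_X ^ 2) ^ Suc e = V"
  proof -
    have "U oo fps_X ^ 2 = (D oo fps_X ^ 2) * (1 - fps_const (of_real (1 / R)) * fps_X ^ 2) ^ \<gamma>"
      unfolding U_def
      by (simp add: fps_compose_power[symmetric] fps_compose_sub_distrib fps_compose_mult_distrib)
    also have "\<dots> = A * (1 - fps_const (of_real (1 / R)) * fps_X ^ 2) ^ \<gamma> * D"
      unfolding AD[symmetric] by (simp add: mult_ac)
    finally show ?thesis
      unfolding V_def e using D0 by (simp add: mult.assoc inverse_mult_eq_1' del: power_Suc)
  qed
  have h_exp: "h has_fps_expansion D" using taylor by (simp add: D_def)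
  have g_exp: "g has_fps_expansion U"
  proof -
    have exp: "(\<lambda>w. h w * (1 - of_real (1 / R) * w) ^ \<gamma>) has_fps_expansion U"
      unfolding U_def by (intro fps_expansion_intros h_exp)
    have "eventually (\<lambda>w. w \<noteq> complex_of_real R) (nhds 0)"
      using R_pos by (intro t1_space_nhds) auto
    then have ev: "eventually (\<lambda>w. h w * (1 - of_real (1 / R) * w) ^ \<gamma> = g w) (nhds 0)"
    proof eventually_elim
      case (elim w)
      have "1 - of_real (1 / R) * w = (w - of_real R) * (- 1 / of_real R)"
        using R_pos by (simp add: field_simps)
      then have "(1 - of_real (1 / R) * w) ^ \<gamma> = (w - of_real R) ^ \<gamma> * (- 1 / of_real R) ^ \<gamma>"
        by (simp only: power_mult_distrib)
      then show ?case using elim by (simp add: g_def g0_def)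
    qed
    show ?thesis by (rule iffD1[OF has_fps_expansion_cong[OF ev refl] exp])
  qed
  have f_exp: "recip_value h has_fps_expansion inverse D"
  proof -
    show ?thesis
      using has_fps_expansion_inverse[OF h_exp D0] recip_value_eq_inverse[OF meromorphic] by simp
  qed
  define K where "K = (\<lambda>z. g (z ^ 2) * recip_value h z)"
  have K_exp: "K has_fps_expansion V"
  proof -
    have "(g \<circ> (\<lambda>z. z ^ 2)) has_fps_expansion (U oo fps_X ^ 2)"
      by (intro has_fps_expansion_compose g_exp fps_expansion_intros) simp
    then show ?thesis
      unfolding K_def V_def by (intro has_fps_expansion_mult f_exp) (simp add: o_def)
  qed
  define \<rho> where "\<rho> = min \<rho>1 (sqrt \<rho>2)"
  have \<rho>: "\<rho> > r" using \<rho>1(1) \<rho>2(1) by (simp add: \<rho>_def r_def)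
  have K_hol: "K holomorphic_on eball 0 (ereal \<rho>)"
  proof -
    have "(\<lambda>z. g (z ^ 2)) holomorphic_on ball 0 \<rho>"
    proof (rule holomorphic_on_compose_gen[OF _ \<rho>2(2), of "\<lambda>z. z ^ 2" "ball 0 \<rho>", unfolded o_def])
      show "(\<lambda>z :: complex. z ^ 2) ` ball 0 \<rho> \<subseteq> ball 0 \<rho>2"
      proof safe
        fix z :: complex assume "z \<in> ball 0 \<rho>"
        then have "norm z < sqrt \<rho>2" by (simp add: \<rho>_def)
        then have "norm z ^ 2 < sqrt \<rho>2 ^ 2" by (intro power_strict_mono) auto
        then show "z ^ 2 \<in> ball 0 \<rho>2" using \<rho>2(1) R_pos by (simp add: norm_power)
      qed
    qed (intro holomorphic_intros)
    moreover have "recip_value h holomorphic_on ball 0 \<rho>"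
      using \<rho>1(2) by (rule holomorphic_on_subset) (auto simp: \<rho>_def)
    ultimately show ?thesis unfolding K_def by (simp add: holomorphic_on_mult)
  qed
  have g_hol: "g holomorphic_on eball 0 (ereal \<rho>2)" using \<rho>2(2) by simp

  have lim_d: "(\<lambda>m. of_nat (d m) / of_real (c m * (1 / R) ^ m)) \<longlonglongrightarrow> g (of_real R)"
  proof -
    have "ereal (norm (complex_of_real R)) < fps_conv_radius U"
      using holomorphic_on_imp_fps_conv_radius_ge[OF g_exp g_hol] \<rho>2(1) R_pos
      by (auto intro: less_le_trans[of _ "ereal \<rho>2"])
    then have "summable (\<lambda>k. norm (U $ k * of_real R ^ k))" by (rule norm_summable_fps)
    then have sm: "summable (\<lambda>k. norm (U $ k) / (1 / R) ^ k)"
      using R_pos by (simp add: norm_mult norm_power power_divide)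
    have "(\<lambda>k. U $ k * of_real R ^ k) sums g (of_real R)"
      using \<rho>2(1) R_pos by (intro has_fps_expansion_imp_sums_complex[OF g_exp g_hol]) auto
    then have "suminf (\<lambda>k. U $ k / of_real (1 / R) ^ k) = g (of_real R)"
      by (simp add: sums_iff power_divide)
    moreover have "of_nat (d m) = (\<Sum>k\<le>m. U $ k * of_real (c (m - k) * (1 / R) ^ (m - k)))" for m
      using fps_nth_of_mult_power[of D "1 / R" e U m] by (simp add: U_def e D_def c_def)
    ultimately show ?thesis
      using tendsto_convolution_binomial[OF _ sm, of e] R_pos by (simp add: c_def)
  qed
  have K_sums: "(\<lambda>k. V $ k * of_real r ^ k) sums K (of_real r)"
      "(\<lambda>k. V $ k * (- of_real r) ^ k) sums K (- of_real r)"
    using \<rho> r(1) by (intro has_fps_expansion_imp_sums_complex[OF K_exp K_hol]; simp)+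
  note parts = sums_even_odd_parts[OF K_sums]
  have "ereal (norm (complex_of_real r)) < fps_conv_radius V"
    using holomorphic_on_imp_fps_conv_radius_ge[OF K_exp K_hol] \<rho> r(1)
    by (auto intro: less_le_trans[of _ "ereal \<rho>"])
  then have V_summable: "summable (\<lambda>k. norm (V $ k * of_real r ^ k))" by (rule norm_summable_fps)
  have K_val: "K (of_real r) = g (of_real R) * recip_value h (of_real r)"
      "K (- of_real r) = g (of_real R) * recip_value h (- of_real r)"
    by (simp_all add: K_def r(2))
  have lim_even: "(\<lambda>n. of_int (a (2 * n)) / of_real (c n * (1 / R) ^ n)) \<longlonglongrightarrow>
      g (of_real R) * (recip_value h (of_real r) + recip_value h (- of_real r)) / 2"
  proof -
    have "summable ((\<lambda>k. norm (V $ k * of_real r ^ k)) \<circ> (\<lambda>k. 2 * k))"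
      using V_summable by (rule summable_reindex) (auto simp: inj_def)
    then have sm: "summable (\<lambda>k. norm (V $ (2 * k)) / (1 / R) ^ k)"
      using r by (simp add: o_def norm_mult norm_power power_divide power_mult)
    have "suminf (\<lambda>k. V $ (2 * k) / of_real (1 / R) ^ k) = (K (of_real r) + K (- of_real r)) / 2"
      using parts(1) r by (simp add: sums_iff power_divide power_mult)
    then have val: "suminf (\<lambda>k. V $ (2 * k) / of_real (1 / R) ^ k) =
        g (of_real R) * (recip_value h (of_real r) + recip_value h (- of_real r)) / 2"
      unfolding K_val by (simp only: distrib_left)
    have coeff: "of_int (a (2 * n)) = (\<Sum>k\<le>n. V $ (2 * k) * of_real (c (n - k) * (1 / R) ^ (n - k)))" for n
      using fps_nth_of_mult_power_square[OF AV, of 0 n] by (simp add: A_def c_def)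
    show ?thesis
      unfolding coeff val[symmetric] c_def
      using R_pos by (intro tendsto_convolution_binomial sm) simp
  qed
  have lim_odd: "(\<lambda>n. of_int (a (2 * n + 1)) / of_real (c n * (1 / R) ^ n)) \<longlonglongrightarrow>
      g (of_real R) * (recip_value h (of_real r) - recip_value h (- of_real r)) / (2 * of_real r)"
  proof -
    have "summable ((\<lambda>k. norm (V $ k * of_real r ^ k)) \<circ> (\<lambda>k. 2 * k + 1))"
      using V_summable by (rule summable_reindex) (auto simp: inj_def)
    then have "summable (\<lambda>k. norm (V $ (2 * k + 1) * of_real r ^ (2 * k + 1)) / r)"
      by (intro summable_divide) (simp add: o_def)
    then have sm: "summable (\<lambda>k. norm (V $ (2 * k + 1)) / (1 / R) ^ k)"
      using r by (simp add: norm_mult norm_power power_divide power_mult)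
    have "(\<lambda>k. V $ (2 * k + 1) * of_real r ^ (2 * k + 1) / of_real r) sums
        ((K (of_real r) - K (- of_real r)) / 2 / of_real r)"
      by (intro sums_divide parts(2))
    then have "suminf (\<lambda>k. V $ (2 * k + 1) / of_real (1 / R) ^ k) = (K (of_real r) - K (- of_real r)) / 2 / of_real r"
      using r by (simp add: sums_iff power_divide power_mult)
    then have val: "suminf (\<lambda>k. V $ (2 * k + 1) / of_real (1 / R) ^ k) =
        g (of_real R) * (recip_value h (of_real r) - recip_value h (- of_real r)) / (2 * of_real r)"
      unfolding K_val by (simp only: right_diff_distrib divide_divide_eq_left)
    have coeff: "of_int (a (2 * n + 1)) = (\<Sum>k\<le>n. V $ (2 * k + 1) * of_real (c (n - k) * (1 / R) ^ (n - k)))" for n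
      using fps_nth_of_mult_power_square[OF AV, of 1 n] by (simp add: A_def c_def)
    show ?thesis
      unfolding coeff val[symmetric] c_def
      using R_pos by (intro tendsto_convolution_binomial sm) simp
  qed
  \<comment> \<open>The sum governs even indices, the difference odd ones. If \<open>r\<close> is a pole (\<open>R = 1\<close>), one term is zero.\<close>
  have ne: "recip_value h (of_real r) + recip_value h (- of_real r) \<noteq> 0"
    "recip_value h (of_real r) - recip_value h (- of_real r) \<noteq> 0"
  proof -
    have "- complex_of_real r \<noteq> of_real R" using r(1) R_pos
      by (metis Re_complex_of_real add.inverse_inverse less_asym' neg_less_0_iff_less of_real_minus)
    then have "\<not> is_pole h (- of_real r)" using pole_iff[of "- of_real r"] r_le r(1) by simp
    then have minus: "recip_value h (- of_real r) = 1 / h (- of_real r)" "h (- of_real r) \<noteq> 0"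
      using nonzero[of "- of_real r"] r(1) by (auto simp: recip_value_def r_def)
    show "recip_value h (of_real r) + recip_value h (- of_real r) \<noteq> 0"
      "recip_value h (of_real r) - recip_value h (- of_real r) \<noteq> 0"
    proof -
      consider "is_pole h (of_real r)" | "\<not> is_pole h (of_real r)" by blast
      then have "recip_value h (of_real r) + recip_value h (- of_real r) \<noteq> 0 \<and>
          recip_value h (of_real r) - recip_value h (- of_real r) \<noteq> 0"
      proof cases
        case 1
        then show ?thesis using minus by (simp add: recip_value_def[of h "of_real r"])
      next
        case 2
        then have plus: "recip_value h (of_real r) = 1 / h (of_real r)" "h (of_real r) \<noteq> 0"
          using nonzero[of "of_real r"] r(1) by (auto simp: recip_value_def r_def)
        have "h (- of_real r) \<noteq> h (of_real r)" "h (- of_real r) \<noteq> - h (of_real r)"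
          using not_pm 2 by (auto simp: r_def)
        then show ?thesis
          unfolding plus(1) minus(1) using plus(2) minus(2)
          by (auto simp: add_frac_eq diff_frac_eq eq_neg_iff_add_eq_0)
      qed
      then show "recip_value h (of_real r) + recip_value h (- of_real r) \<noteq> 0"
        "recip_value h (of_real r) - recip_value h (- of_real r) \<noteq> 0" by blast+
    qed
  qed
  have "R powr (real m / 2) = r ^ m" for m
    using R_pos by (simp add: r_def powr_half_sqrt[symmetric] powr_power)
  then show ?thesis
    using ratio_asymptotics[OF r gR ne lim_d[unfolded c_def] lim_even[unfolded c_def] lim_odd[unfolded c_def]]
    by (simp add: e r_def[symmetric])
qed

section \<open>The asymptotic formula\<close>

text \<open>Because the first term of \<open>d\<close> is one, the convolution equation can be solved recursively over
the integers, and the solution over the field is unique.\<close>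

lemma convolution_solution_integral:
  fixes t :: "nat \<Rightarrow> 'k::field_char_0" and d :: "nat \<Rightarrow> nat" and c :: "nat \<Rightarrow> int"
  assumes d0: "d 0 = 1" and conv: "\<And>m. (\<Sum>p\<le>m. of_nat (d p) * t (m - p)) = of_int (c m)"
  obtains a :: "nat \<Rightarrow> int"
  where "\<And>m. of_int (a m) = t m" "\<And>m. (\<Sum>p\<le>m. int (d p) * a (m - p)) = c m"
proof -
  have "\<exists>z::int. of_int z = t m" for m
  proof (induction m rule: less_induct)
    case (less m)
    define T where "T = (\<Sum>p<m. of_nat (d (Suc p)) * t (m - Suc p))"
    have "T \<in> \<int>"
      unfolding T_def
    proof (intro Ints_sum Ints_mult Ints_of_nat)
      fix p assume "p \<in> {..<m}"
      then obtain z where "of_int z = t (m - Suc p)" using less[of "m - Suc p"] by auto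
      then show "t (m - Suc p) \<in> \<int>" by (metis Ints_of_int)
    qed
    then obtain z where z: "T = of_int z" by (auto elim: Ints_cases)
    have "of_int (c m) = t m + T"
      unfolding conv[symmetric] T_def by (simp add: sum.atMost_shift d0)
    then have "of_int (c m - z) = t m" by (simp add: z)
    then show ?case by blast
  qed
  then obtain a :: "nat \<Rightarrow> int" where a: "\<And>m. of_int (a m) = t m" by metis
  have "of_int (\<Sum>p\<le>m. int (d p) * a (m - p)) = (of_int (c m) :: 'k)" for m
    by (simp add: a conv)
  then have "(\<Sum>p\<le>m. int (d p) * a (m - p)) = c m" for m
    by (simp only: of_int_eq_iff)
  with a show thesis by (rule that)
qed

theorem corollary17:
  fixes smul :: "'k::field_char_0 \<Rightarrow> 'a::ring_1 \<Rightarrow> 'a"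
    and \<Delta> :: "'a \<Rightarrow> ('a \<times> 'a \<Rightarrow>\<^sub>0 'k)"
    and counit :: "'a \<Rightarrow> 'k"
    and G :: "nat \<Rightarrow> 'a set"
    and S :: "'a \<Rightarrow> 'a"
    and h :: "complex \<Rightarrow> complex"
    and R :: real
    and \<gamma> :: nat
  assumes hopf: "graded_connected_hopf_algebra smul \<Delta> counit G"
    and antipode: "bialgebra.is_antipode smul \<Delta> counit S"
    and not_one_dim: "vector_space.dim smul (UNIV :: 'a set) \<noteq> 1"
    and finite_dim: "\<And>m. \<exists>B. finite B \<and> module.span smul B = G m"
    and meromorphic: "h nicely_meromorphic_on UNIV"
    and taylor: "h has_fps_expansion Abs_fps (\<lambda>m. of_nat (vector_space.dim smul (G m)))"
    and R_pos: "0 < R"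
    and R_dominant: "is_pole h (of_real R)" "\<And>z. is_pole h z \<Longrightarrow> R \<le> cmod z"
    and R_unique: "{z. is_pole h z \<and> cmod z \<le> R powr (1/4)} = {of_real R}"
    and order: "zorder h (of_real R) = - int \<gamma>"
    and nonzero: "\<And>z. cmod z \<le> sqrt R \<Longrightarrow> \<not> is_pole h z \<Longrightarrow> h z \<noteq> 0"
    and not_pm: "\<not> is_pole h (of_real (sqrt R)) \<Longrightarrow>
          h (- of_real (sqrt R)) \<noteq> h (of_real (sqrt R)) \<and>
          h (- of_real (sqrt R)) \<noteq> - h (of_real (sqrt R))"
  shows "\<exists>a :: nat \<Rightarrow> int.
      (\<forall>m. of_int (a m) = trace_on smul (G m) S) \<and>
      (\<lambda>m. (of_int (a m) / of_nat (vector_space.dim smul (G m))) /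
           (of_real (R powr (real m / 2)) / 2 ^ \<gamma> *
              (recip_value h (of_real (sqrt R)) +
               (-1) ^ m * recip_value h (- of_real (sqrt R)))))
        \<longlonglongrightarrow> (1 :: complex)"
proof -
  interpret graded_connected_hopf_algebra smul \<Delta> counit G by (rule hopf)
  interpret hopf_finite_type smul \<Delta> counit G S
    using antipode finite_dim by unfold_locales
  have d0: "dim (G 0) = 1" by (rule connected)
  obtain a :: "nat \<Rightarrow> int" where a: "\<And>m. of_int (a m) = trace_on smul (G m) S"
    and conv: "\<And>m. (\<Sum>p\<le>m. int (dim (G p)) * a (m - p)) = (if even m then int (dim (G (m div 2))) else 0)"
  proof (rule convolution_solution_integral[of "\<lambda>m. dim (G m)" "\<lambda>m. trace_on smul (G m) S"])
    show "(\<Sum>p\<le>m. of_nat (dim (G p)) * trace_on smul (G (m - p)) S) =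
        of_int (if even m then int (dim (G (m div 2))) else 0)" for m
      unfolding trace_antipode_convolution by simp
  qed (use d0 in auto)
  have d0': "dim (G 0) \<noteq> 0" using d0 by simp
  show ?thesis
    using a convolution_ratio_asymptotics[OF meromorphic taylor d0' conv R_pos R_dominant(1) R_unique
        order nonzero not_pm]
    by blast
qed

end
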